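(* Let $n\ge 3$, let $q$ be a prime power, and let $J\subseteq\{1,\dots,n\}$ satisfy $J=J^{w_0}$. If $C$ is an EKR-set of flags of cotype $J$ in $\mathrm{PG}(n,q)$, then $$|C|\le\frac{v}{1+q^{(n+1)/2}},$$ where $v=[G:P_J]$ is the total number of flags of cotype $J$.
   Context: Let $V=\mathbb{F}_q^{n+1}$ with standard basis $e_1,\dots,e_{n+1}$; $\mathrm{PG}(n,q)$ is the geometry of subspaces of $V$, and dimension always means vector space dimension. A flag is a set of pairwise incident (i.e. comparable by inclusion) proper nonzero subspaces; its type is the set of dimensions of its members and its cotype is the complement of the type in $\{1,\dots,n\}$. Maximal flags are flags of cotype $\emptyset$. Let $G=\mathrm{PGL}(n+1,q)$, $F=\{\langle e_1\rangle,\dots,\langle e_1,\dots,e_n\rangle\}$, and $B$ the stabilizer of $F$ in $G$. The Weyl group $W=\mathrm{Sym}(n+1)$, with generators $s_i=(i,i+1)$, acts by $we_i=e_{w(i)}$, and its longest element is $w_0=(1,n+1)(2,n)\cdots$. For $J\subseteq\{1,\dots,n\}$, $W_J=\langle s_i: i\in J\rangle$ and $P_J=BW_JB$, which is the stabilizer of the flag of cotype $J$ contained in $F$. Identifying $i$ with $s_i$, $J^{w_0}$ is the conjugate of $J$ by $w_0$, i.e. $J^{w_0}=\{n+1-j: j\in J\}$. Two maximal flags $gF,hF$ are opposite if $Bh^{-1}gB=Bw_0B$. Two flags of cotypes $J$ and $K$ are opposite if $J^{w_0}=K$ and they can be extended to two opposite maximal flags. A set $C$ of flags of cotype $J$ (with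 $J^{w_0}=J$) is an EKR-set if no two flags of $C$ are opposite. *)

theory Defs
  imports "HOL-Analysis.Cartesian_Space" "HOL-Analysis.Determinants" "HOL-Algebra.Sym_Groups"
begin

text \<open>
  The ambient space is \<open>V = 'a ^ 'm\<close> with \<open>'a\<close> a finite field of order \<open>q\<close> and \<open>'m\<close> a finite
  linearly ordered index type with \<open>n + 1\<close> elements, so that \<open>{1..n} = {1..<CARD('m)}\<close>.
  The order on \<open>'m\<close> only serves to number the standard basis \<open>e\<^sub>1, \<dots>, e\<^sub>n\<^sub>+\<^sub>1\<close>.
\<close>

type_synonym ('a, 'm) sq_matrix = "'a ^ 'm ^ 'm"
type_synonym ('a, 'm) point_set = "('a ^ 'm) set"
type_synonym ('a, 'm) flag = "('a ^ 'm) set set"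

definition basis_vec :: "nat \<Rightarrow> 'a::field ^ 'm::{finite,linorder}" where
  "basis_vec i = axis (sorted_list_of_set UNIV ! (i - 1)) 1"


section \<open>Flags of the projective geometry\<close>

definition is_flag :: "('a::field, 'm::finite) flag \<Rightarrow> bool" where
  "is_flag f \<longleftrightarrow>
     (\<forall>U\<in>f. vec.subspace U \<and> U \<noteq> {0} \<and> U \<noteq> UNIV) \<and>
     (\<forall>U\<in>f. \<forall>W\<in>f. U \<subseteq> W \<or> W \<subseteq> U)"

definition flag_type :: "('a::field, 'm::finite) flag \<Rightarrow> nat set" where
  "flag_type f = vec.dim ` f"

definition flag_cotype :: "('a::field, 'm::finite) flag \<Rightarrow> nat set" where
  "flag_cotype f = {1..<CARD('m)} - flag_type f"

definition flags_of_cotype :: "nat set \<Rightarrow> ('a::field, 'm::finite) flag set" where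
  "flags_of_cotype J = {f. is_flag f \<and> flag_cotype f = J}"

definition std_flag :: "('a::field, 'm::{finite,linorder}) flag" where
  "std_flag = (\<lambda>k. vec.span (basis_vec ` {1..k})) ` {1..<CARD('m)}"


section \<open>The group \<open>PGL(n+1,q)\<close> and its action\<close>

definition GL :: "('a::field, 'm::finite) sq_matrix monoid" where
  "GL = \<lparr>carrier = {A. invertible A}, mult = (**), one = mat 1\<rparr>"

definition scalar_matrices :: "('a::field, 'm::finite) sq_matrix set" where
  "scalar_matrices = {mat c | c. c \<noteq> 0}"

definition PGL :: "('a::field, 'm::finite) sq_matrix set monoid" where
  "PGL = GL Mod scalar_matrices"

definition proj_class :: "('a::field, 'm::finite) sq_matrix \<Rightarrow> ('a, 'm) sq_matrix set" where
  "proj_class A = scalar_matrices #>\<^bsub>GL\<^esub> A"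

text \<open>
  All representatives of a class in \<open>PGL\<close> map a given subspace to the same subspace, so the union
  below is the image of the subspace under any one of them.
\<close>

definition act_subspace ::
    "('a::field, 'm::finite) sq_matrix set \<Rightarrow> ('a, 'm) point_set \<Rightarrow> ('a, 'm) point_set" where
  "act_subspace g U = (\<Union>A\<in>g. (\<lambda>x. A *v x) ` U)"

definition act_flag ::
    "('a::field, 'm::finite) sq_matrix set \<Rightarrow> ('a, 'm) flag \<Rightarrow> ('a, 'm) flag" where
  "act_flag g f = act_subspace g ` f"

definition borel_subgroup :: "('a::field, 'm::{finite,linorder}) sq_matrix set set" where
  "borel_subgroup = {g \<in> carrier PGL. act_flag g std_flag = std_flag}"


section \<open>The Weyl group and parabolic subgroups\<close>

text \<open>
  The Weyl group is \<open>sym_group (n + 1)\<close>, the permutations of \<open>{1..n+1}\<close>; \<open>w\<close> is sent to the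
  class of the matrix whose column at the \<open>i\<close>-th index is \<open>e\<^sub>w\<^sub>(\<^sub>i\<^sub>)\<close>.
\<close>

definition perm_matrix :: "(nat \<Rightarrow> nat) \<Rightarrow> ('a::field, 'm::{finite,linorder}) sq_matrix" where
  "perm_matrix w =
     (\<chi> r c. \<Sum>i | i \<in> {1..CARD('m)} \<and> c = sorted_list_of_set UNIV ! (i - 1). basis_vec (w i) $ r)"

lemma perm_matrix_basis_vec:
  assumes "i \<in> {1..CARD('m)}"
  shows "perm_matrix w *v (basis_vec i :: 'a::field ^ 'm::{finite,linorder}) = basis_vec (w i)"
proof -
  let ?l = "sorted_list_of_set (UNIV :: 'm set)"
  have "distinct ?l" "length ?l = CARD('m)" by simp_all
  then have eq: "{j. j \<in> {1..CARD('m)} \<and> ?l ! (i - 1) = ?l ! (j - 1)} = {i}"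
    using assms by (auto simp: nth_eq_iff_index_eq)
  have "perm_matrix w *v (basis_vec i :: ('a, 'm) vec) = column (?l ! (i - 1)) (perm_matrix w)"
    by (simp add: basis_vec_def vec_eq_iff matrix_vector_mult_def axis_def column_def if_distrib cong: if_cong)
  then show ?thesis
    by (simp add: vec_eq_iff column_def perm_matrix_def eq del: One_nat_def atLeastAtMost_iff)
qed

definition weyl :: "(nat \<Rightarrow> nat) \<Rightarrow> ('a::field, 'm::{finite,linorder}) sq_matrix set" where
  "weyl w = proj_class (perm_matrix w)"

definition longest_perm :: "nat \<Rightarrow> nat \<Rightarrow> nat" where
  "longest_perm n i = (if i \<in> {1..n + 1} then n + 2 - i else i)"

definition weyl_parabolic :: "nat \<Rightarrow> nat set \<Rightarrow> (nat \<Rightarrow> nat) set" where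
  "weyl_parabolic n J = generate (sym_group (n + 1)) ((\<lambda>i. Transposition.transpose i (i + 1)) ` J)"

definition parabolic :: "nat set \<Rightarrow> ('a::field, 'm::{finite,linorder}) sq_matrix set set" where
  "parabolic J =
     (borel_subgroup <#>\<^bsub>PGL\<^esub> (weyl ` weyl_parabolic (CARD('m) - 1) J)) <#>\<^bsub>PGL\<^esub> borel_subgroup"

definition conj_w0 :: "nat \<Rightarrow> nat set \<Rightarrow> nat set" where
  "conj_w0 n J = {n + 1 - j | j. j \<in> J}"


section \<open>Opposition and EKR-sets\<close>

definition borel_double_coset ::
    "('a::field, 'm::{finite,linorder}) sq_matrix set \<Rightarrow> ('a, 'm) sq_matrix set set" where
  "borel_double_coset g = (borel_subgroup <#>\<^bsub>PGL\<^esub> {g}) <#>\<^bsub>PGL\<^esub> borel_subgroup"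

definition opposite_maximal ::
    "('a::field, 'm::{finite,linorder}) flag \<Rightarrow> ('a, 'm) flag \<Rightarrow> bool" where
  "opposite_maximal f f' \<longleftrightarrow>
     (\<exists>g\<in>carrier PGL. \<exists>h\<in>carrier PGL. f = act_flag g std_flag \<and> f' = act_flag h std_flag \<and>
        borel_double_coset (inv\<^bsub>PGL\<^esub> h \<otimes>\<^bsub>PGL\<^esub> g) =
        borel_double_coset (weyl (longest_perm (CARD('m) - 1))))"

definition opposite ::
    "('a::field, 'm::{finite,linorder}) flag \<Rightarrow> ('a, 'm) flag \<Rightarrow> bool" where
  "opposite f f' \<longleftrightarrow>
     conj_w0 (CARD('m) - 1) (flag_cotype f) = flag_cotype f' \<and>
     (\<exists>m m'. m \<in> flags_of_cotype {} \<and> m' \<in> flags_of_cotype {} \<and> f \<subseteq> m \<and> f' \<subseteq> m' \<and>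
        opposite_maximal m m')"

text \<open>
  The two flags in the EKR condition are not required to be distinct. A nonempty flag is never
  opposite to itself, so this matters only for \<open>J = {1..n}\<close>: the sole flag of cotype \<open>J\<close> is
  then the empty one, which is opposite to itself.
\<close>

definition EKR_set :: "nat set \<Rightarrow> ('a::field, 'm::{finite,linorder}) flag set \<Rightarrow> bool" where
  "EKR_set J C \<longleftrightarrow> C \<subseteq> flags_of_cotype J \<and> (\<forall>f\<in>C. \<forall>f'\<in>C. \<not> opposite f f')"

end

theory Submission imports Defs "HOL-Analysis.Convex_Euclidean_Space"
begin

text \<open>
Let \<open>N = n (n + 1) / 2\<close> be the length of \<open>w\<^sub>0\<close>. Maximal flags are called chambers below.

Reduction to chambers. Two flags are opposite as soon as they lie in opposite chambers, so the
chambers that extend the members of \<open>C\<close> are pairwise non-opposite. Since \<open>PGL(n+1,q)\<close> is transitive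
on the flags of cotype \<open>J\<close>, each of these flags lies in the same number \<open>m\<close> of chambers. The bound
for \<open>J\<close> is therefore the bound for chambers, divided by \<open>m\<close>.

Chambers. On the real functions on chambers there is for each \<open>i\<close> an operator \<open>T\<^sub>i\<close>, which sums a function
over the \<open>q\<close> chambers that differ from a given one exactly in the member of dimension \<open>i + 1\<close>. These
operators are self-adjoint and satisfy the relations of the Hecke algebra of type \<open>A\<^sub>n\<close>. The product
\<open>T\<^sub>w\<^sub>0\<close> of the \<open>T\<^sub>i\<close> along a reduced word of \<open>w\<^sub>0\<close> only relates opposite chambers (\<open>longest_support\<close>), has
all row sums equal to \<open>q\<^sup>N\<close>, and on the orthogonal complement of the constants it satisfies
\<open>|T\<^sub>w\<^sub>0 y|\<^sup>2 \<le> q\<^bsup>2N - (n+1)\<^esup> |y|\<^sup>2\<close> (\<open>longest_gap\<close>). Splitting the indicator function of a set without opposite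
pairs into its mean and a part \<open>y\<close> orthogonal to the constants, as in the ratio bound of Hoffman, gives
the bound for chambers (\<open>chamber_EKR_bound\<close>).

The spectral gap. This is pure algebra in representations of the Hecke algebra, and by induction on
the rank \<open>k\<close>. One has \<open>T\<^sub>w\<^sub>0 = c T'\<close>, where \<open>T'\<close> belongs to the longest element of the subgroup of rank
\<open>k\<close> and \<open>c = T\<^sub>0 \<dots> T\<^sub>k\<close>. The operator \<open>c\<^sup>* c\<close> is a Jucys-Murphy element, hence commutes with the
subalgebra of rank \<open>k\<close>. On the vectors fixed by that subalgebra (up to the scalar \<open>q\<close>), but orthogonal
to those fixed by everything, \<open>c\<^sup>* c\<close> is the scalar \<open>q\<^sup>k\<close> (\<open>murphy_reflection\<close>); this is the reflection
representation, and the bound is attained there. On the complement of these vectors the induction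
hypothesis applies to \<open>T'\<close>, and it suffices that \<open>c\<^sup>* c \<le> q\<^bsup>2k+1\<^esup>\<close> there (\<open>murphy_gap\<close>). In terms of Young
tableaux: the eigenvalues of \<open>c\<^sup>* c\<close> are \<open>q\<^bsup>k+1+a\<^esup>\<close> with \<open>a\<close> the content of the last box, and \<open>a\<close> takes its maximal
value \<open>k + 1\<close> only for the tableau with one row.

The group. Any two chambers are spanned by the initial segments of one basis, taken in two different
orders (\<open>adapted_frame\<close>, the Bruhat decomposition). This yields transitivity, shows that chambers in
general position are opposite in the sense of double cosets, and identifies \<open>B W\<^sub>J B\<close> with the stabilizer of
a flag, so that \<open>[G : P\<^sub>J]\<close> is the number of flags of cotype \<open>J\<close>.
\<close>

section \<open>Representations of the Hecke algebra of type A\<close>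

text \<open>
The form \<open>L x \<bullet> x\<close> attains its maximum on the compact unit sphere of \<open>U\<close>, and a point where it does is
an eigenvector. This replaces the spectral theorem below: a single eigenvector is enough there.
\<close>

lemma eigenvector_above:
  fixes L :: "'v::euclidean_space \<Rightarrow> 'v"
  assumes L: "linear L" and sa: "\<And>v w. L v \<bullet> w = v \<bullet> L w"
    and U: "subspace U" and LU: "\<And>v. v \<in> U \<Longrightarrow> L v \<in> U"
    and x: "x \<in> U" "L x \<bullet> x > c * (x \<bullet> x)"
  obtains \<beta> v where "v \<in> U" "v \<noteq> 0" "\<beta> > c" "L v = \<beta> *\<^sub>R v"
proof -
  interpret L: linear L by (rule L)
  have x0: "x \<noteq> 0" using x(2) by (auto simp: L.zero)
  let ?S = "sphere 0 1 \<inter> U"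
  have "compact ?S" by (intro compact_Int_closed closed_subspace U) auto
  moreover have unit: "(1 / norm w) *\<^sub>R w \<in> ?S" if "w \<in> U" "w \<noteq> 0" for w
    using that U by (auto simp: subspace_scale)
  moreover have "continuous_on ?S (\<lambda>v. L v \<bullet> v)"
    by (intro continuous_intros linear_continuous_on linear_conv_bounded_linear[THEN iffD1] L)
  ultimately obtain v where v: "v \<in> ?S" and mx: "\<And>w. w \<in> ?S \<Longrightarrow> L w \<bullet> w \<le> L v \<bullet> v"
    using continuous_attains_sup[of ?S "\<lambda>v. L v \<bullet> v"] x(1) x0 by blast
  define \<beta> where "\<beta> = L v \<bullet> v"
  have vv: "v \<bullet> v = 1" and vU: "v \<in> U" using v by (auto simp: dot_square_norm)
  have bound: "L w \<bullet> w \<le> \<beta> * (w \<bullet> w)" if "w \<in> U" for w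
  proof (cases "w = 0")
    case False
    have "L ((1 / norm w) *\<^sub>R w) \<bullet> ((1 / norm w) *\<^sub>R w) \<le> \<beta>"
      unfolding \<beta>_def by (rule mx[OF unit[OF that False]])
    then have "(L w \<bullet> w) / (norm w)\<^sup>2 \<le> \<beta>"
      by (simp add: L.scale power2_eq_square)
    then show ?thesis using False by (simp add: dot_square_norm field_simps)
  qed (simp add: L.zero)
  define w where "w = \<beta> *\<^sub>R v - L v"
  have wU: "w \<in> U" unfolding w_def using U vU LU by (simp add: subspace_diff subspace_scale)
  define a where "a = w \<bullet> w"
  define b where "b = \<beta> * (w \<bullet> w) - L w \<bullet> w"
  have b: "b \<ge> 0" unfolding b_def using bound[OF wU] by simp
  \<comment> \<open>The quadratic form \<open>\<beta> |u|\<^sup>2 - L u \<bullet> u\<close> is nonnegative on \<open>U\<close> and vanishes at \<open>v\<close>, so its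
    gradient \<open>2 w\<close> at \<open>v\<close> must vanish too.\<close>
  have q: "0 \<le> 2 * t * a + t\<^sup>2 * b" for t
  proof -
    have "v + t *\<^sub>R w \<in> U" using U vU wU by (simp add: subspace_add subspace_scale)
    from bound[OF this] have "0 \<le> \<beta> * ((v + t *\<^sub>R w) \<bullet> (v + t *\<^sub>R w)) - L (v + t *\<^sub>R w) \<bullet> (v + t *\<^sub>R w)"
      by simp
    also have "\<dots> = \<beta> * (v \<bullet> v) - L v \<bullet> v + 2 * t * (\<beta> * (v \<bullet> w) - L v \<bullet> w) + t\<^sup>2 * b"
      unfolding b_def using sa[of v w]
      by (simp add: L.add L.scale inner_add_left inner_add_right algebra_simps power2_eq_square inner_commute)
    also have "\<dots> = 2 * t * a + t\<^sup>2 * b"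
      unfolding a_def vv by (simp add: \<beta>_def w_def inner_diff_left)
    finally show ?thesis .
  qed
  have "a = 0"
  proof (rule ccontr)
    assume "a \<noteq> 0"
    define t where "t = - a / (b + 1)"
    have t: "t * (b + 1) = - a" using b by (simp add: t_def)
    have "(2 * t * a + t\<^sup>2 * b) * (b + 1)\<^sup>2
        = 2 * a * (b + 1) * (t * (b + 1)) + b * (t * (b + 1))\<^sup>2"
      by (simp add: algebra_simps power2_eq_square)
    also have "\<dots> = - (a\<^sup>2 * (b + 2))"
      unfolding t by (simp add: algebra_simps power2_eq_square)
    also have "\<dots> < 0" using \<open>a \<noteq> 0\<close> b by simp
    finally show False using q[of t] by (simp add: mult_less_0_iff)
  qed
  then have "L v = \<beta> *\<^sub>R v" by (simp add: a_def w_def)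
  moreover have "\<beta> > c"
  proof -
    have "c * (x \<bullet> x) < \<beta> * (x \<bullet> x)" using x(2) bound[OF x(1)] by simp
    then show ?thesis using x0 by (simp add: mult_less_cancel_right)
  qed
  moreover have "v \<noteq> 0" using vv by auto
  ultimately show ?thesis using that vU by blast
qed

text \<open>
Indices start at \<open>0\<close>, so that \<open>T i\<close> belongs to the simple reflection \<open>s\<^sub>i\<^sub>+\<^sub>1\<close>, and the first \<open>k\<close> operators
generate the algebra of the subgroup \<open>Sym(k + 1)\<close>. Self-adjointness provides orthogonal complements of
invariant subspaces.
\<close>

locale hecke_representation =
  fixes q :: real and n :: nat and T :: "nat \<Rightarrow> 'v::euclidean_space \<Rightarrow> 'v"
  assumes q: "q > 1"
    and linear_T: "i < n \<Longrightarrow> linear (T i)"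
    and self_adjoint_T: "i < n \<Longrightarrow> T i v \<bullet> w = v \<bullet> T i w"
    and quadratic: "i < n \<Longrightarrow> T i (T i v) = (q - 1) *\<^sub>R T i v + q *\<^sub>R v"
    and commute: "i + 1 < j \<Longrightarrow> j < n \<Longrightarrow> T i (T j v) = T j (T i v)"
    and braid: "Suc i < n \<Longrightarrow> T i (T (Suc i) (T i v)) = T (Suc i) (T i (T (Suc i) v))"
begin

text \<open>
The eigenvalue is \<open>q\<close> rather than \<open>1\<close> because \<open>T \<mapsto> q\<close> is the analogue of the trivial character. On functions on
chambers these are the functions that only depend on the members of dimension \<open>> k\<close>.
\<close>

definition fixed :: "nat \<Rightarrow> 'v set" where
  "fixed k = {v. \<forall>i<k. T i v = q *\<^sub>R v}"

definition cofixed :: "nat \<Rightarrow> 'v set" where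
  "cofixed k = {v. \<forall>w\<in>fixed k. v \<bullet> w = 0}"

text \<open>
The multiplicative Jucys-Murphy element \<open>T\<^sub>k\<^sub>-\<^sub>1 \<dots> T\<^sub>0 T\<^sub>0 \<dots> T\<^sub>k\<^sub>-\<^sub>1\<close>.
\<close>

primrec murphy :: "nat \<Rightarrow> 'v \<Rightarrow> 'v" where
  "murphy 0 v = v"
| "murphy (Suc k) v = T k (murphy k (T k v))"

text \<open>
The vector \<open>coset_sum (Suc k) v = v + T\<^sub>k v + T\<^sub>k\<^sub>-\<^sub>1 T\<^sub>k v + \<dots> + T\<^sub>0 \<dots> T\<^sub>k v\<close> is a sum over the
shortest representatives of the left cosets of \<open>Sym(k + 1)\<close> in \<open>Sym(k + 2)\<close>.
\<close>

primrec coset_sum :: "nat \<Rightarrow> 'v \<Rightarrow> 'v" where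
  "coset_sum 0 v = v"
| "coset_sum (Suc k) v = v + coset_sum k (T k v)"

text \<open>
The Coxeter element \<open>T\<^sub>0 \<dots> T\<^sub>k\<^sub>-\<^sub>1\<close>, and the longest element of \<open>Sym(k + 1)\<close> along the reduced word
\<open>(s\<^sub>1 \<dots> s\<^sub>k) (s\<^sub>1 \<dots> s\<^sub>k\<^sub>-\<^sub>1) \<dots> (s\<^sub>1)\<close>.
\<close>

primrec coxeter :: "nat \<Rightarrow> 'v \<Rightarrow> 'v" where
  "coxeter 0 v = v"
| "coxeter (Suc k) v = coxeter k (T k v)"

primrec longest :: "nat \<Rightarrow> 'v \<Rightarrow> 'v" where
  "longest 0 v = v"
| "longest (Suc k) v = coxeter (Suc k) (longest k v)"

primrec longest_length :: "nat \<Rightarrow> nat" where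
  "longest_length 0 = 0"
| "longest_length (Suc k) = longest_length k + Suc k"

lemma T_add: "i < n \<Longrightarrow> T i (v + w) = T i v + T i w"
  and T_scale: "i < n \<Longrightarrow> T i (c *\<^sub>R v) = c *\<^sub>R T i v"
  using linear_T[of i] by (auto simp: linear_add linear_cmul)

lemma T_norm: assumes "i < n" shows "T i v \<bullet> T i v \<le> q\<^sup>2 * (v \<bullet> v)"
proof -
  have e: "T i v \<bullet> T i v = (q - 1) * (T i v \<bullet> v) + q * (v \<bullet> v)"
    using self_adjoint_T[OF assms, of "T i v" v] quadratic[OF assms, of v]
    by (simp add: inner_add_left)
  have "0 \<le> (T i v - q *\<^sub>R v) \<bullet> (T i v - q *\<^sub>R v)" by simp
  also have "\<dots> = (q + 1) * (q * (v \<bullet> v) - T i v \<bullet> v)"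
    by (simp add: e inner_diff_left inner_diff_right inner_commute algebra_simps power2_eq_square)
  finally have "T i v \<bullet> v \<le> q * (v \<bullet> v)"
    using q by (simp add: zero_le_mult_iff)
  then have "(q - 1) * (T i v \<bullet> v) \<le> (q - 1) * (q * (v \<bullet> v))"
    using q by (intro mult_left_mono) auto
  then show ?thesis unfolding e by (simp add: algebra_simps power2_eq_square)
qed

lemma linear_murphy: "k \<le> n \<Longrightarrow> linear (murphy k)"
proof (induction k)
  case 0 then show ?case by (simp add: linear_iff)
next
  case (Suc k) then show ?case by (simp add: linear_iff T_add T_scale)
qed

lemma linear_longest: "k \<le> n \<Longrightarrow> linear (longest k)"
proof (induction k)
  case (Suc k)
  have "j \<le> n \<Longrightarrow> linear (coxeter j)" for j
    by (induction j) (simp_all add: linear_iff T_add T_scale)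
  then show ?case using Suc by (simp add: linear_iff T_add T_scale del: coxeter.simps)
qed (simp add: linear_iff)

lemma self_adjoint_murphy: "k \<le> n \<Longrightarrow> murphy k v \<bullet> w = v \<bullet> murphy k w"
  by (induction k arbitrary: v w) (simp_all add: self_adjoint_T)

lemma T_murphy_above: "i < n \<Longrightarrow> k < i \<Longrightarrow> T i (murphy k v) = murphy k (T i v)"
proof (induction k arbitrary: v)
  case (Suc k)
  then show ?case by (simp add: commute[of k i, symmetric])
qed simp

text \<open>
For \<open>i = k - 1\<close> the braid relation carries \<open>T i\<close> past \<open>T k T\<^sub>k\<^sub>-\<^sub>1\<close>, where it becomes \<open>T k\<close>. That commutes with
the inner Jucys-Murphy element and is turned back by a second braid relation.
\<close>

lemma T_murphy_below: "i < k \<Longrightarrow> k < n \<Longrightarrow> T i (murphy (Suc k) v) = murphy (Suc k) (T i v)"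
proof (induction k arbitrary: v)
  case (Suc k)
  show ?case
  proof (cases "i < k")
    case True
    then show ?thesis using Suc commute[of i "Suc k"] by simp
  next
    case False
    then have i: "i = k" using Suc by simp
    have "T k (murphy (Suc (Suc k)) v) = T k (T (Suc k) (T k (murphy k (T k (T (Suc k) v)))))" by simp
    also have "\<dots> = T (Suc k) (T k (murphy k (T (Suc k) (T k (T (Suc k) v)))))"
      using Suc by (simp add: braid T_murphy_above)
    also have "\<dots> = murphy (Suc (Suc k)) (T k v)"
      using Suc by (simp add: braid)
    finally show ?thesis by (simp add: i)
  qed
qed simp

lemma murphy_commute: "j \<le> k \<Longrightarrow> k < n \<Longrightarrow> murphy j (murphy (Suc k) v) = murphy (Suc k) (murphy j v)"
proof (induction j arbitrary: v)
  case (Suc j)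
  define M where "M = murphy (Suc k)"
  have "T j (M w) = M (T j w)" for w
    unfolding M_def using Suc.prems by (intro T_murphy_below) auto
  moreover have "murphy j (M w) = M (murphy j w)" for w
    unfolding M_def using Suc by simp
  ultimately show ?case unfolding M_def[symmetric] by simp
qed simp

lemma subspace_fixed: "k \<le> n \<Longrightarrow> subspace (fixed k)"
  by (auto simp: subspace_def fixed_def T_add T_scale scaleR_add_right linear_0[OF linear_T])

lemma subspace_cofixed: "subspace (cofixed k)"
  by (auto simp: subspace_def cofixed_def inner_add_left)

lemma fixed_mono: "j \<le> k \<Longrightarrow> fixed k \<subseteq> fixed j"
  by (auto simp: fixed_def)

lemma fixed_cofixed: "v \<in> fixed k \<Longrightarrow> v \<in> cofixed k \<Longrightarrow> v = 0"
  by (auto simp: cofixed_def)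

lemma fixed_cofixed_decomp:
  assumes "k \<le> n" obtains a b where "a \<in> fixed k" "b \<in> cofixed k" "v = a + b"
proof -
  have s: "span (fixed k) = fixed k" using subspace_fixed[OF assms] by simp
  obtain a b where "a \<in> fixed k" "\<And>w. w \<in> fixed k \<Longrightarrow> orthogonal b w" "v = a + b"
    using orthogonal_subspace_decomp_exists[of "fixed k" v] unfolding s by blast
  then show ?thesis using that by (auto simp: cofixed_def orthogonal_def)
qed

lemma T_cofixed: "i < k \<Longrightarrow> k \<le> n \<Longrightarrow> v \<in> cofixed k \<Longrightarrow> T i v \<in> cofixed k"
  by (auto simp: cofixed_def self_adjoint_T fixed_def)

lemma murphy_cofixed: "j \<le> k \<Longrightarrow> k \<le> n \<Longrightarrow> v \<in> cofixed k \<Longrightarrow> murphy j v \<in> cofixed k"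
  by (induction j arbitrary: v) (simp_all add: T_cofixed)

lemma longest_cofixed: "j \<le> k \<Longrightarrow> k \<le> n \<Longrightarrow> v \<in> cofixed k \<Longrightarrow> longest j v \<in> cofixed k"
proof (induction j)
  case (Suc j)
  have "i \<le> k \<Longrightarrow> w \<in> cofixed k \<Longrightarrow> coxeter i w \<in> cofixed k" for i w
    using Suc.prems by (induction i arbitrary: w) (simp_all add: T_cofixed)
  then show ?case using Suc by (simp del: coxeter.simps)
qed simp

lemma murphy_fixed: "k \<le> n \<Longrightarrow> v \<in> fixed k \<Longrightarrow> murphy k v = q ^ (2 * k) *\<^sub>R v"
proof (induction k)
  case (Suc k)
  have "v \<in> fixed k" using Suc.prems fixed_mono[of k "Suc k"] by auto
  moreover have "T k v = q *\<^sub>R v" using Suc.prems by (simp add: fixed_def)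
  ultimately show ?case using Suc
    by (simp add: linear_cmul[OF linear_murphy] T_scale power_add power2_eq_square mult_ac)
qed simp

lemma coxeter_fixed: "k \<le> n \<Longrightarrow> v \<in> fixed k \<Longrightarrow> coxeter k v = q ^ k *\<^sub>R v"
proof (induction k arbitrary: v)
  case (Suc k)
  then have "T k v = q *\<^sub>R v" by (simp add: fixed_def)
  moreover have "q *\<^sub>R v \<in> fixed k"
    using Suc.prems fixed_mono[of k "Suc k"] subspace_fixed[of k] by (auto simp: subspace_scale)
  ultimately show ?case using Suc by (simp add: mult_ac)
qed simp

lemma longest_fixed: "k \<le> n \<Longrightarrow> v \<in> fixed k \<Longrightarrow> longest k v = q ^ longest_length k *\<^sub>R v"
proof (induction k)
  case (Suc k)
  have vk: "v \<in> fixed k" using Suc.prems fixed_mono[of k "Suc k"] by auto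
  have "q ^ longest_length k *\<^sub>R v \<in> fixed (Suc k)"
    using Suc.prems subspace_fixed[of "Suc k"] by (auto simp: subspace_scale)
  then show ?case using Suc vk
    by (simp add: coxeter_fixed power_add mult_ac del: coxeter.simps)
qed simp

lemma coxeter_adjoint: "k \<le> n \<Longrightarrow> coxeter k v \<bullet> coxeter k w = murphy k v \<bullet> w"
  by (induction k arbitrary: v w) (simp_all add: self_adjoint_T)

lemma murphy_upper: "k \<le> n \<Longrightarrow> murphy k v \<bullet> v \<le> q ^ (2 * k) * (v \<bullet> v)"
proof (induction k arbitrary: v)
  case (Suc k)
  have "murphy (Suc k) v \<bullet> v = murphy k (T k v) \<bullet> T k v" using Suc by (simp add: self_adjoint_T)
  also have "\<dots> \<le> q ^ (2 * k) * (T k v \<bullet> T k v)" using Suc by simp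
  also have "\<dots> \<le> q ^ (2 * k) * (q\<^sup>2 * (v \<bullet> v))"
    using Suc T_norm[of k v] q by (intro mult_left_mono) auto
  finally show ?case by (simp add: power2_eq_square mult_ac)
qed simp

text \<open>
Left multiplication by a generator permutes the cosets, so the sum over coset representatives is
fixed by all generators up to the scalar \<open>q\<close>.
\<close>

lemma coset_sum_fixed:
  assumes "k < n" "v \<in> fixed k"
  shows "coset_sum (Suc k) v \<in> fixed (Suc k)"
proof -
  have lin: "j \<le> n \<Longrightarrow> linear (coset_sum j)" for j
    by (induction j) (auto simp: linear_iff T_add T_scale scaleR_add_right)
  have ST: "i < n \<Longrightarrow> j < i \<Longrightarrow> T i (coset_sum j w) = coset_sum j (T i w)" for i j w
  proof (induction j arbitrary: w)
    case (Suc j)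
    then show ?case using commute[of j i] by (simp add: T_add)
  qed simp
  show ?thesis using assms
  proof (induction k arbitrary: v)
    case 0
    then show ?case by (simp add: fixed_def T_add quadratic scaleR_add_right algebra_simps)
  next
    case (Suc k)
    let ?u = "T (Suc k) v"
    have Tv: "T i v = q *\<^sub>R v" if "i \<le> k" for i using Suc.prems that by (simp add: fixed_def)
    have "?u \<in> fixed k"
      using Suc.prems Tv by (auto simp: fixed_def commute[of _ "Suc k"] T_scale)
    then have IH: "coset_sum (Suc k) ?u \<in> fixed (Suc k)" using Suc by simp
    have low: "T i (coset_sum (Suc (Suc k)) v) = q *\<^sub>R coset_sum (Suc (Suc k)) v" if "i \<le> k" for i
      using IH that Suc.prems Tv[OF that]
      by (simp add: T_add fixed_def scaleR_add_right del: coset_sum.simps(2)[of k])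
    have "T (Suc k) (coset_sum (Suc (Suc k)) v)
        = ?u + T (Suc k) ?u + coset_sum k (T (Suc k) (T k ?u))"
      using Suc.prems by (simp add: T_add ST)
    also have "T (Suc k) (T k ?u) = q *\<^sub>R T k ?u"
      using Suc.prems by (simp add: braid[symmetric] Tv T_scale)
    also have "?u + T (Suc k) ?u + coset_sum k (q *\<^sub>R T k ?u) = q *\<^sub>R coset_sum (Suc (Suc k)) v"
      using Suc.prems
      by (simp add: quadratic linear_cmul[OF lin] scaleR_add_right algebra_simps)
    finally have "T (Suc k) (coset_sum (Suc (Suc k)) v) = q *\<^sub>R coset_sum (Suc (Suc k)) v" .
    with low show ?case unfolding fixed_def by (auto simp: less_Suc_eq_le le_Suc_eq simp del: coset_sum.simps)
  qed
qed

text \<open>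
In the Hecke algebra, \<open>murphy (Suc k)\<close> is \<open>q\<^bsup>k+1\<^esup>\<close> plus \<open>q - 1\<close> times a combination of the elements of the
transpositions \<open>(j, k + 2)\<close>; on \<open>fixed k\<close> these act as multiples of the coset representatives.
\<close>

lemma murphy_on_fixed:
  assumes "k < n" "v \<in> fixed k"
  shows "murphy (Suc k) v = q ^ k *\<^sub>R (v + (q - 1) *\<^sub>R coset_sum (Suc k) v)"
  using assms
proof (induction k arbitrary: v)
  case 0
  then show ?case by (simp add: quadratic algebra_simps)
next
  case (Suc k)
  let ?u = "T (Suc k) v"
  have u: "?u \<in> fixed k"
    using Suc.prems by (auto simp: fixed_def commute[of _ "Suc k"] T_scale)
  have "T (Suc k) (coset_sum (Suc (Suc k)) v) = q *\<^sub>R coset_sum (Suc (Suc k)) v"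
    using coset_sum_fixed[OF Suc.prems] by (simp add: fixed_def del: coset_sum.simps)
  then have TS: "T (Suc k) (coset_sum (Suc k) ?u) = q *\<^sub>R coset_sum (Suc (Suc k)) v - ?u"
    using Suc.prems by (simp add: T_add algebra_simps del: coset_sum.simps(2)[of k])
  have "murphy (Suc (Suc k)) v = T (Suc k) (q ^ k *\<^sub>R (?u + (q - 1) *\<^sub>R coset_sum (Suc k) ?u))"
    using Suc.IH[OF _ u] Suc.prems by (simp del: coset_sum.simps murphy.simps(2)[of k])
  also have "\<dots> = q ^ k *\<^sub>R (T (Suc k) ?u + (q - 1) *\<^sub>R T (Suc k) (coset_sum (Suc k) ?u))"
    using Suc.prems by (simp add: T_add T_scale del: coset_sum.simps)
  also have "\<dots> = q ^ k *\<^sub>R (q *\<^sub>R (v + (q - 1) *\<^sub>R coset_sum (Suc (Suc k)) v))"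
    unfolding TS using Suc.prems by (simp add: quadratic algebra_simps del: coset_sum.simps)
  finally show ?case by (simp add: mult_ac del: coset_sum.simps murphy.simps)
qed

text \<open>
The coset sum of such a vector is both fixed by all generators and orthogonal to all such vectors, so
it vanishes. In terms of Young tableaux, the last box has content \<open>-1\<close>.
\<close>

lemma murphy_reflection:
  assumes "k < n" "v \<in> fixed k" "v \<in> cofixed (Suc k)"
  shows "murphy (Suc k) v = q ^ k *\<^sub>R v"
proof -
  have "murphy (Suc k) v - q ^ k *\<^sub>R v = (q ^ k * (q - 1)) *\<^sub>R coset_sum (Suc k) v"
    using murphy_on_fixed[OF assms(1,2)] by (simp add: scaleR_add_right del: murphy.simps coset_sum.simps)
  moreover have "murphy (Suc k) v - q ^ k *\<^sub>R v \<in> cofixed (Suc k)"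
    using assms subspace_cofixed[of "Suc k"] murphy_cofixed[of "Suc k" "Suc k" v]
    by (simp add: subspace_diff subspace_scale del: murphy.simps)
  moreover have "(q ^ k * (q - 1)) *\<^sub>R coset_sum (Suc k) v \<in> fixed (Suc k)"
    using assms coset_sum_fixed subspace_fixed[of "Suc k"] by (simp add: subspace_scale del: coset_sum.simps)
  ultimately have "murphy (Suc k) v - q ^ k *\<^sub>R v = 0" using fixed_cofixed by metis
  then show ?thesis by simp
qed

text \<open>
The content argument for Young tableaux, carried out for one eigenvector \<open>x\<close> whose eigenvalue \<open>\<beta>\<close> is
too large. The relation \<open>murphy k T\<^sub>k = T\<^sub>k\<^sup>-\<^sup>1 murphy (Suc k)\<close> says that exchanging the last two boxes would
produce the eigenvalue \<open>\<beta> / q\<close> of \<open>murphy k\<close>, which exceeds its norm. Hence the last two boxes are adjacent, and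
in the same row because \<open>\<beta>\<close> is large: \<open>T\<^sub>k x = q x\<close>. Then \<open>murphy k\<close> has on \<open>x\<close> an eigenvalue beyond its own
gap, so that \<open>x\<close> lies in \<open>fixed k\<close> by induction, and altogether in \<open>fixed (Suc k)\<close>.
\<close>

lemma murphy_gap:
  assumes "k \<le> n" "v \<in> cofixed k"
  shows "q * (murphy k v \<bullet> v) \<le> q ^ (2 * k) * (v \<bullet> v)"
  using assms
proof (induction k arbitrary: v)
  case 0
  then have "v = 0" by (auto simp: cofixed_def fixed_def)
  then show ?case by simp
next
  case (Suc k)
  have k: "k < n" using Suc.prems by simp
  define c where "c = q ^ (2 * k + 1)"
  have "murphy (Suc k) v \<bullet> v \<le> c * (v \<bullet> v)"
  proof (rule ccontr)
    assume "\<not> ?thesis"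
    then obtain \<beta> x where x: "x \<in> cofixed (Suc k)" "x \<noteq> 0" and \<beta>: "\<beta> > c"
      and ev: "murphy (Suc k) x = \<beta> *\<^sub>R x"
      using eigenvector_above[of "murphy (Suc k)" "cofixed (Suc k)" v c] Suc.prems
        linear_murphy[of "Suc k"] self_adjoint_murphy[of "Suc k"] subspace_cofixed murphy_cofixed[of "Suc k" "Suc k"]
      by (metis linorder_not_le order_refl)
    have cpos: "c > 0" using q by (simp add: c_def)
    \<comment> \<open>\<open>murphy k\<close> has no eigenvalue as large as \<open>\<beta> / q\<close>.\<close>
    have no_eig: "y = 0" if "murphy k y = \<gamma> *\<^sub>R y" "\<gamma> \<ge> \<beta> / q" for y \<gamma>
    proof (rule ccontr)
      assume "y \<noteq> 0"
      then have "\<gamma> \<le> q ^ (2 * k)" using murphy_upper[of k y] k that(1) by simp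
      moreover have "\<beta> / q > q ^ (2 * k)" using \<beta> q by (simp add: c_def field_simps)
      ultimately show False using that(2) by simp
    qed
    \<comment> \<open>Multiply \<open>murphy (Suc k) z = \<beta> z\<close> by \<open>T\<^sub>k\<^sup>-\<^sup>1 = (T\<^sub>k - (q - 1)) / q\<close>.\<close>
    have LT: "murphy k (T k z) = (\<beta> / q) *\<^sub>R (T k z - (q - 1) *\<^sub>R z)" if "murphy (Suc k) z = \<beta> *\<^sub>R z" for z
    proof -
      have "(q - 1) *\<^sub>R murphy (Suc k) z + q *\<^sub>R murphy k (T k z) = \<beta> *\<^sub>R T k z"
        using quadratic[OF k, of "murphy k (T k z)"] that by (metis murphy.simps(2) T_scale k)
      then have "q *\<^sub>R murphy k (T k z) = \<beta> *\<^sub>R (T k z - (q - 1) *\<^sub>R z)"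
        by (simp add: that algebra_simps del: murphy.simps)
      then have "(1/q) *\<^sub>R (q *\<^sub>R murphy k (T k z)) = (1/q) *\<^sub>R (\<beta> *\<^sub>R (T k z - (q - 1) *\<^sub>R z))" by simp
      then show ?thesis using q by simp
    qed
    interpret Lk: linear "murphy k" using linear_murphy k by simp
    interpret LS: linear "murphy (Suc k)" using linear_murphy[of "Suc k"] k by simp
    interpret Tk: linear "T k" using linear_T k by simp
    \<comment> \<open>Hence the eigenspace of \<open>\<beta>\<close> is stable under \<open>T k\<close>.\<close>
    have stable: "murphy (Suc k) (T k x) = \<beta> *\<^sub>R T k x"
    proof -
      define y where "y = murphy (Suc k) (T k x) - \<beta> *\<^sub>R T k x"
      have "murphy k y = murphy (Suc k) (murphy k (T k x)) - \<beta> *\<^sub>R murphy k (T k x)"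
        unfolding y_def using murphy_commute[of k k] k by (simp add: Lk.diff Lk.scale del: murphy.simps)
      also have "\<dots> = (\<beta> / q) *\<^sub>R y"
        unfolding LT[OF ev] y_def
        by (simp add: LS.diff LS.add LS.scale ev algebra_simps del: murphy.simps)
      finally have "y = 0" by (rule no_eig) simp
      then show ?thesis by (simp add: y_def)
    qed
    \<comment> \<open>On it \<open>T k\<close> has no eigenvalue \<open>- 1\<close>, since \<open>murphy k\<close> would have the eigenvalue \<open>\<beta>\<close>.\<close>
    have Tx: "T k x = q *\<^sub>R x"
    proof -
      define y where "y = q *\<^sub>R x - T k x"
      have Ty: "T k y = - y"
        unfolding y_def by (simp add: Tk.diff Tk.scale quadratic[OF k] algebra_simps)
      have Ly: "murphy (Suc k) y = \<beta> *\<^sub>R y"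
        unfolding y_def by (simp add: LS.diff LS.scale ev stable algebra_simps del: murphy.simps)
      have "- murphy k y = (\<beta> / q) *\<^sub>R (- y - (q - 1) *\<^sub>R y)"
        using LT[OF Ly] by (simp add: Ty Lk.neg)
      also have "\<dots> = - (\<beta> *\<^sub>R y)" using q by (simp add: algebra_simps)
      finally have "murphy k y = \<beta> *\<^sub>R y" by simp
      then have "y = 0" using \<beta> cpos q by (intro no_eig) (auto simp: field_simps)
      then show ?thesis by (simp add: y_def)
    qed
    have Lx: "murphy k x = (\<beta> / q\<^sup>2) *\<^sub>R x"
    proof -
      have "q *\<^sub>R murphy k x = (\<beta> / q) *\<^sub>R x"
        using LT[OF ev] unfolding Tx by (simp add: Lk.scale algebra_simps)
      then have "(1 / q) *\<^sub>R (q *\<^sub>R murphy k x) = (1 / q) *\<^sub>R ((\<beta> / q) *\<^sub>R x)" by simp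
      then show ?thesis using q by (simp add: power2_eq_square)
    qed
    obtain a b where ab: "a \<in> fixed k" "b \<in> cofixed k" "x = a + b"
      using fixed_cofixed_decomp[of k x] k by auto
    \<comment> \<open>The component \<open>b\<close> would be an eigenvector of \<open>murphy k\<close> that violates the induction hypothesis.\<close>
    have "b = 0"
    proof (rule ccontr)
      assume "b \<noteq> 0"
      have "a \<bullet> b = 0" "murphy k a \<bullet> b = 0"
        using ab k by (auto simp: murphy_fixed cofixed_def inner_commute)
      moreover have "murphy k a \<bullet> b + murphy k b \<bullet> b = (\<beta> / q\<^sup>2) * (a \<bullet> b + b \<bullet> b)"
        using Lx unfolding ab(3) Lk.add by (metis inner_add_left inner_scaleR_left)
      ultimately have "murphy k b \<bullet> b = (\<beta> / q\<^sup>2) * (b \<bullet> b)" by simp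
      then have "q * (\<beta> / q\<^sup>2) * (b \<bullet> b) \<le> q ^ (2 * k) * (b \<bullet> b)"
        using Suc.IH[of b] k ab by simp
      moreover have "q * (\<beta> / q\<^sup>2) = \<beta> / q" using q by (simp add: power2_eq_square)
      ultimately have "\<beta> / q \<le> q ^ (2 * k)" using \<open>b \<noteq> 0\<close>
        by (metis inner_gt_zero_iff mult_le_cancel_right_pos)
      then show False using \<beta> q by (simp add: c_def field_simps)
    qed
    then have "x \<in> fixed (Suc k)" using ab Tx by (auto simp: fixed_def less_Suc_eq)
    then show False using x fixed_cofixed by blast
  qed
  then have "q * (murphy (Suc k) v \<bullet> v) \<le> q * (c * (v \<bullet> v))" using q by (intro mult_left_mono) auto
  then show ?case by (simp add: c_def mult_ac)
qed

text \<open>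
The components \<open>a\<close> and \<open>b\<close> of \<open>v\<close> stay orthogonal under \<open>longest (Suc k)\<close> because \<open>murphy (Suc k)\<close> commutes
with the subalgebra of rank \<open>k\<close>. On \<open>a\<close> the estimate is an equality; on \<open>b\<close> it combines \<open>murphy_gap\<close> with
the induction hypothesis.
\<close>

theorem longest_gap:
  assumes "k \<le> n" "v \<in> cofixed k"
  shows "q ^ (k + 1) * (longest k v \<bullet> longest k v) \<le> q ^ (2 * longest_length k) * (v \<bullet> v)"
  using assms
proof (induction k arbitrary: v)
  case 0
  then have "v = 0" by (auto simp: cofixed_def fixed_def)
  then show ?case by simp
next
  case (Suc k)
  have k: "k < n" using Suc.prems by simp
  interpret LS: linear "murphy (Suc k)" using linear_murphy[of "Suc k"] k by simp
  obtain a b where ab: "a \<in> fixed k" "b \<in> cofixed k" "v = a + b"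
    using fixed_cofixed_decomp[of k v] k by auto
  have bS: "b \<in> cofixed (Suc k)" using ab fixed_mono[of k "Suc k"] by (auto simp: cofixed_def)
  have "a = v - b" using ab by simp
  then have aS: "a \<in> cofixed (Suc k)"
    using Suc.prems bS subspace_cofixed by (simp add: subspace_diff)
  define u where "u = longest k b"
  have u: "u \<in> cofixed k" "u \<in> cofixed (Suc k)"
    using longest_cofixed[of k k b] longest_cofixed[of k "Suc k" b] ab bS k by (auto simp: u_def)
  define Q where "Q = q ^ longest_length k"
  have La: "murphy (Suc k) a = q ^ k *\<^sub>R a" by (rule murphy_reflection[OF k ab(1) aS])
  have au: "a \<bullet> u = 0" "u \<bullet> a = 0" "a \<bullet> b = 0" "b \<bullet> a = 0"
    using u ab by (auto simp: cofixed_def inner_commute)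
  have Wv: "longest k v = Q *\<^sub>R a + u"
    using k ab by (simp add: linear_add[OF linear_longest] longest_fixed u_def Q_def)
  have "murphy (Suc k) u \<bullet> a = 0"
    using self_adjoint_murphy[of "Suc k" u a] k La au by simp
  then have "longest (Suc k) v \<bullet> longest (Suc k) v = Q\<^sup>2 * q ^ k * (a \<bullet> a) + murphy (Suc k) u \<bullet> u"
    using k La au
    by (simp add: Wv coxeter_adjoint LS.add LS.scale inner_add_left inner_add_right power2_eq_square mult_ac
        del: coxeter.simps murphy.simps)
  moreover have "q ^ (k + 2) * (murphy (Suc k) u \<bullet> u) \<le> q ^ (2 * longest_length (Suc k)) * (b \<bullet> b)"
  proof -
    have "q ^ (k + 2) * (murphy (Suc k) u \<bullet> u) = q ^ (k + 1) * (q * (murphy (Suc k) u \<bullet> u))" by simp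
    also have "\<dots> \<le> q ^ (k + 1) * (q ^ (2 * Suc k) * (u \<bullet> u))"
      using murphy_gap[of "Suc k" u] u k q by (intro mult_left_mono) (auto simp del: murphy.simps)
    also have "\<dots> = q ^ (2 * Suc k) * (q ^ (k + 1) * (u \<bullet> u))" by (simp only: mult_ac)
    also have "\<dots> \<le> q ^ (2 * Suc k) * (q ^ (2 * longest_length k) * (b \<bullet> b))"
      using Suc.IH[of b] ab k q unfolding u_def by (intro mult_left_mono) auto
    also have "\<dots> = q ^ (2 * longest_length (Suc k)) * (b \<bullet> b)" by (simp add: power_add power_mult_distrib mult_ac)
    finally show ?thesis .
  qed
  moreover have "q ^ (k + 2) * (Q\<^sup>2 * q ^ k * (a \<bullet> a)) = q ^ (2 * longest_length (Suc k)) * (a \<bullet> a)"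
    by (simp add: Q_def power_add power2_eq_square mult_ac mult_2 mult_2_right)
  moreover have "v \<bullet> v = a \<bullet> a + b \<bullet> b"
    using ab(3) au by (simp add: inner_add_left inner_add_right)
  ultimately show ?case by (simp only: distrib_left Suc_eq_plus1[symmetric] add_2_eq_Suc')
qed

end

lemma dim_insert_subspace:
  fixes W :: "('a::field ^ 'm::finite) set"
  assumes "vec.subspace W" "x \<notin> W"
  shows "vec.dim (insert x W) = Suc (vec.dim W)"
  using assms by (metis vec.dim_insert vec.span_eq_iff Suc_eq_plus1)

section \<open>Chambers and panels\<close>

lemma subspace_eqI:
  fixes U W :: "('a::field ^ 'm::finite) set"
  assumes "vec.subspace U" "vec.subspace W" "U \<subseteq> W" "vec.dim W \<le> vec.dim U"
  shows "U = W"
  using vec.subspace_dim_equal assms by blast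

lemma subspace_between:
  fixes U X :: "('a::field ^ 'm::finite) set"
  assumes "vec.subspace U" "vec.subspace X" "U \<subseteq> X" "vec.dim U \<le> k" "k \<le> vec.dim X"
  shows "\<exists>W. vec.subspace W \<and> U \<subseteq> W \<and> W \<subseteq> X \<and> vec.dim W = k"
  using assms(4,5)
proof (induction k rule: dec_induct)
  case base
  then show ?case using assms by auto
next
  case (step k)
  then obtain W where W: "vec.subspace W" "U \<subseteq> W" "W \<subseteq> X" "vec.dim W = k" by auto
  then have "W \<noteq> X" using step by auto
  then obtain x where x: "x \<in> X" "x \<notin> W" using W by auto
  have "vec.span (insert x W) \<subseteq> X" using x W assms by (intro vec.span_minimal) auto
  moreover have "vec.dim (vec.span (insert x W)) = Suc k"
    using x W by (simp add: dim_insert_subspace)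
  moreover have "U \<subseteq> vec.span (insert x W)" using W by (auto intro: vec.span_base)
  ultimately show ?case by (intro exI[of _ "vec.span (insert x W)"]) auto
qed

lemma chain_below:
  fixes K :: "('a::field ^ 'm::finite) set"
  assumes "vec.subspace K" "vec.dim K = j"
  shows "\<exists>c. (\<forall>i. vec.subspace (c i)) \<and> (\<forall>i. c i \<subseteq> c (Suc i)) \<and>
    (\<forall>i. vec.dim (c i) = min i j) \<and> c j = K"
  using assms
proof (induction j arbitrary: K)
  case 0
  then show ?case by (intro exI[of _ "\<lambda>_. K"]) auto
next
  case (Suc j)
  obtain K' where K': "vec.subspace K'" "K' \<subseteq> K" "vec.dim K' = j"
    using subspace_between[of "{0}" K j] Suc.prems vec.subspace_0 by auto
  obtain c where c: "\<forall>i. vec.subspace (c i)" "\<forall>i. c i \<subseteq> c (Suc i)"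
    "\<forall>i. vec.dim (c i) = min i j" "c j = K'" using Suc.IH[OF K'(1,3)] by auto
  have "c i \<subseteq> K" if "i \<le> j" for i
    using lift_Suc_mono_le[of c i j] c K' that by auto
  then show ?case using c K' Suc.prems
    by (intro exI[of _ "\<lambda>i. if i \<le> j then c i else K"]) auto
qed

text \<open>
Chambers are sequences indexed by the dimension rather than sets of subspaces: members can then be
addressed and exchanged by their dimension. The sequence includes \<open>{0}\<close> and the whole space, which are
the neighbours of the first and the last proper member.
\<close>

typedef (overloaded) ('a::field, 'm::finite) chamber =
  "{F :: nat \<Rightarrow> ('a ^ 'm) set. (\<forall>i. vec.subspace (F i)) \<and> (\<forall>i. F i \<subseteq> F (Suc i)) \<and>
      (\<forall>i. vec.dim (F i) = min i CARD('m))}"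
  morphisms mem chamber_of
  using chain_below[of "UNIV :: ('a ^ 'm) set" "CARD('m)"] vec_dim_card[where ?'a='a and ?'n='m]
  by (auto simp del: vec.dim_UNIV)

lemma subspace_mem [simp]: "vec.subspace (mem F i)"
  and mem_Suc: "mem F i \<subseteq> mem F (Suc i)"
  and dim_mem: "vec.dim (mem F i) = min i CARD('m)" for F :: "('a::field, 'm::finite) chamber"
  using mem[of F] by auto

lemma mem_mono: "i \<le> j \<Longrightarrow> mem F i \<subseteq> mem F j"
  using lift_Suc_mono_le[of "mem F" i j] mem_Suc by auto

lemma mem_0 [simp]: "mem F 0 = {0}"
  using dim_mem[of F 0] vec.subspace_0[OF subspace_mem[of F 0]] by auto

lemma mem_full: "CARD('m) \<le> i \<Longrightarrow> mem F i = UNIV" for F :: "('a::field, 'm::finite) chamber"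
  using dim_mem[of F i] subspace_eqI[of "mem F i" UNIV]
  by (simp add: vec_dim_card del: vec.dim_UNIV)

lemma zero_mem [simp]: "0 \<in> mem F i"
  using vec.subspace_0[OF subspace_mem] .

lemma span_mem [simp]: "vec.span (mem F i) = mem F i"
  using subspace_mem vec.span_eq_iff by blast

lemma chamber_eqI: "(\<And>i. mem F i = mem G i) \<Longrightarrow> F = G"
  using mem_inject by blast

lemma dim_mem_less [simp]: "i \<le> CARD('m) \<Longrightarrow> vec.dim (mem F i) = i"
  for F :: "('a::field, 'm::finite) chamber"
  by (simp add: dim_mem)

lemma dim_psubset_less:
  fixes U W :: "('a::field ^ 'm::finite) set"
  assumes "vec.subspace U" "vec.subspace W" "U \<subset> W"
  shows "vec.dim U < vec.dim W"
  using subspace_eqI[of U W] assms by force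

instance chamber :: ("{field, finite}", finite) finite
proof
  have "range mem \<subseteq> (\<lambda>c i. if i < CARD('b) then c i else UNIV) `
      (PiE {..<CARD('b)} (\<lambda>_. UNIV :: ('a ^ 'b) set set))"
  proof
    fix c assume "c \<in> range (mem :: ('a, 'b) chamber \<Rightarrow> _)"
    then obtain F :: "('a, 'b) chamber" where "c = mem F" by auto
    then have "c = (\<lambda>i. if i < CARD('b) then (restrict (mem F) {..<CARD('b)}) i else UNIV)"
      by (auto simp: mem_full fun_eq_iff)
    then show "c \<in> (\<lambda>c i. if i < CARD('b) then c i else UNIV) `
      (PiE {..<CARD('b)} (\<lambda>_. UNIV :: ('a ^ 'b) set set))"
      by (intro image_eqI[of _ _ "restrict (mem F) {..<CARD('b)}"]) auto
  qed
  then have "finite (range (mem :: ('a, 'b) chamber \<Rightarrow> _))"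
    by (rule finite_subset) (intro finite_imageI finite_PiE; simp)
  moreover have "inj (mem :: ('a, 'b) chamber \<Rightarrow> _)" by (simp add: inj_def mem_inject)
  ultimately show "finite (UNIV :: ('a, 'b) chamber set)" using finite_imageD by blast
qed

text \<open>
The candidates for the member of dimension \<open>i + 1\<close> when the other members of the chamber are kept.
\<close>

definition panel :: "('a::field, 'm::finite) chamber \<Rightarrow> nat \<Rightarrow> ('a ^ 'm) set set" where
  "panel F i = {U. vec.subspace U \<and> mem F i \<subseteq> U \<and> U \<subseteq> mem F (Suc (Suc i)) \<and> vec.dim U = Suc i}"

definition replace :: "('a::field, 'm::finite) chamber \<Rightarrow> nat \<Rightarrow> ('a ^ 'm) set \<Rightarrow> ('a, 'm) chamber" where
  "replace F i U = chamber_of ((mem F)(Suc i := U))"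

lemma mem_replace:
  fixes F :: "('a::field, 'm::finite) chamber"
  assumes "Suc i < CARD('m)" "U \<in> panel F i"
  shows "mem (replace F i U) = (mem F)(Suc i := U)"
  unfolding replace_def
proof (rule chamber_of_inverse, safe)
  fix j x
  show "vec.subspace (((mem F)(Suc i := U)) j)" using assms by (auto simp: panel_def)
  show "vec.dim (((mem F)(Suc i := U)) j) = min j CARD('m)"
    using assms by (auto simp: panel_def dim_mem)
  show "x \<in> ((mem F)(Suc i := U)) (Suc j)" if "x \<in> ((mem F)(Suc i := U)) j"
    using that assms mem_Suc[of F j] by (auto simp: panel_def split: if_splits)
qed

lemma mem_in_panel: "Suc i < CARD('m) \<Longrightarrow> mem F (Suc i) \<in> panel F i"
  for F :: "('a::field, 'm::finite) chamber"
  using mem_Suc[of F] by (simp add: panel_def)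

lemma replace_same: "Suc i < CARD('m) \<Longrightarrow> replace F i (mem F (Suc i)) = F"
  for F :: "('a::field, 'm::finite) chamber"
  by (rule chamber_eqI) (simp add: mem_replace mem_in_panel)

lemma panel_replace:
  fixes F :: "('a::field, 'm::finite) chamber"
  assumes "Suc i < CARD('m)" "U \<in> panel F i" "j \<noteq> Suc i" "Suc j \<noteq> i"
  shows "panel (replace F i U) j = panel F j"
  using assms by (simp add: panel_def mem_replace)

lemma replace_replace:
  fixes F :: "('a::field, 'm::finite) chamber"
  assumes "Suc i < CARD('m)" "U \<in> panel F i" "U' \<in> panel F i"
  shows "replace (replace F i U) i U' = replace F i U'"
  by (rule chamber_eqI) (use assms in \<open>simp add: mem_replace panel_replace\<close>)

text \<open>
With \<open>x\<close> in the present member \<open>U0\<close> but not in the one below, and \<open>y\<close> in the one above but not in \<open>U0\<close>,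
the other candidates are spanned over \<open>mem F i\<close> by one of the \<open>q\<close> vectors \<open>y + c x\<close>.
\<close>

lemma card_panel:
  fixes F :: "('a::{field,finite}, 'm::finite) chamber"
  assumes "Suc i < CARD('m)"
  shows "card (panel F i) = CARD('a) + 1"
proof -
  define A B where "A = mem F i" and "B = mem F (Suc (Suc i))"
  have A: "vec.subspace A" "vec.dim A = i" and B: "vec.subspace B" "vec.dim B = i + 2"
    and AB: "A \<subseteq> B"
    using assms mem_mono[of i "Suc (Suc i)" F] by (simp_all add: A_def B_def)
  have spA: "vec.span A = A" using A by simp
  define U0 where "U0 = mem F (Suc i)"
  have U0: "vec.subspace U0" "vec.dim U0 = Suc i" "A \<subseteq> U0" "U0 \<subseteq> B"
    using assms mem_Suc by (auto simp: A_def B_def U0_def)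
  have "U0 \<noteq> A" "U0 \<noteq> B" using A B U0 by auto
  then obtain x y where x: "x \<in> U0" "x \<notin> A" and y: "y \<in> B" "y \<notin> U0" using U0 by auto
  have spx: "vec.span (insert x A) = U0"
    using x A U0 by (intro subspace_eqI vec.span_minimal) (auto simp: dim_insert_subspace)
  define U where "U c = vec.span (insert (y + c *s x) A)" for c
  have notin: "y + c *s x \<notin> U0" for c
    using y x U0(1) vec.subspace_diff[OF U0(1), of "y + c *s x" "c *s x"]
    by (auto simp: vec.subspace_scale)
  have panelU: "U c \<in> panel F i" for c
  proof -
    have "y + c *s x \<in> B" using x y U0 B by (auto intro!: vec.subspace_add vec.subspace_scale)
    then have "U c \<subseteq> B" unfolding U_def using AB B by (intro vec.span_minimal) auto
    moreover have "vec.dim (U c) = Suc i"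
      using notin[of c] A U0 dim_insert_subspace[of A "y + c *s x"] by (auto simp: U_def)
    ultimately show ?thesis
      by (auto simp: panel_def U_def A_def[symmetric] B_def[symmetric] intro: vec.span_base)
  qed
  have gen: "y + c *s x \<in> U c" for c unfolding U_def by (auto intro: vec.span_base)
  have only: "W = U0" if W: "W \<in> panel F i" "x \<in> W" for W
  proof -
    have "U0 \<subseteq> W" unfolding spx[symmetric]
      using W by (intro vec.span_minimal) (auto simp: panel_def A_def)
    then show ?thesis using W U0 subspace_eqI[of U0 W] by (auto simp: panel_def)
  qed
  have "inj U"
  proof (rule injI, rule ccontr)
    fix c d assume cd: "U c = U d" "c \<noteq> d"
    have sub: "vec.subspace (U c)" unfolding U_def by simp
    have "(y + c *s x) - (y + d *s x) \<in> U c"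
      using vec.subspace_diff[OF sub gen[of c]] gen[of d] cd(1) by metis
    moreover have "(y + c *s x) - (y + d *s x) = (c - d) *s x"
      by (simp add: vec.scale_left_diff_distrib)
    ultimately have "(c - d) *s x \<in> U c" by (simp only:)
    then have "(1 / (c - d)) *s ((c - d) *s x) \<in> U c" using sub by (rule vec.subspace_scale[rotated])
    then have "x \<in> U c" using cd by simp
    then have "U c = U0" using only panelU by blast
    then show False using gen[of c] notin by auto
  qed
  moreover have "panel F i = insert U0 (range U)"
  proof (intro equalityI subsetI)
    fix W assume "W \<in> insert U0 (range U)"
    then show "W \<in> panel F i" using panelU mem_in_panel assms by (auto simp: U0_def)
  next
    fix W assume W: "W \<in> panel F i"
    then have Ws: "vec.subspace W" "A \<subseteq> W" "W \<subseteq> B" "vec.dim W = Suc i"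
      by (auto simp: panel_def A_def B_def)
    show "W \<in> insert U0 (range U)"
    proof (cases "W = U0")
      case False
      have "\<not> W \<subseteq> U0" using False Ws U0 subspace_eqI[of W U0] by auto
      then obtain w where w: "w \<in> W" "w \<notin> U0" by auto
      have "B = vec.span (insert y U0)"
        using y U0 B by (intro subspace_eqI[symmetric] vec.span_minimal) (auto simp: dim_insert_subspace)
      then obtain k where k: "w - k *s y \<in> U0"
        using w Ws U0 vec.span_breakdown_eq[of w y U0] by (metis subsetD vec.span_eq_iff)
      have k0: "k \<noteq> 0" using k w by auto
      obtain l where l: "w - k *s y - l *s x \<in> A"
        using k spx vec.span_breakdown_eq[of "w - k *s y" x A] spA by auto
      have "k *s y + l *s x \<in> W"
        using vec.subspace_diff[OF Ws(1) w(1), of "w - k *s y - l *s x"] l Ws by auto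
      then have "(1/k) *s (k *s y + l *s x) \<in> W" using Ws by (intro vec.subspace_scale)
      then have "y + (l / k) *s x \<in> W" using k0 by (simp add: vec.scale_right_distrib)
      then have "U (l / k) \<subseteq> W" unfolding U_def using Ws by (intro vec.span_minimal) auto
      then have "U (l / k) = W"
        using panelU[of "l / k"] Ws by (intro subspace_eqI) (auto simp: panel_def)
      then show ?thesis by auto
    qed simp
  qed
  moreover have "U0 \<notin> range U" using gen notin by auto
  ultimately show ?thesis by (simp add: card_image)
qed

section \<open>The action of the Hecke algebra on functions on chambers\<close>

definition panel_op :: "nat \<Rightarrow> real ^ ('a::{field,finite}, 'm::finite) chamber \<Rightarrow> real ^ ('a, 'm) chamber" where
  "panel_op i f = (\<chi> F. \<Sum>U\<in>panel F i - {mem F (Suc i)}. f $ replace F i U)"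

lemma panel_op_nth: "panel_op i f $ F = (\<Sum>U\<in>panel F i - {mem F (Suc i)}. f $ replace F i U)"
  by (simp add: panel_op_def)

lemma panel_op_linear: "linear (panel_op i)"
  by (rule linearI) (simp_all add: vec_eq_iff panel_op_nth sum.distrib sum_distrib_left)

text \<open>
A panel is a set of \<open>q + 1\<close> chambers on which \<open>panel_op i\<close> is the all-ones matrix minus the identity.
\<close>

lemma panel_op_quadratic:
  fixes f :: "real ^ ('a::{field,finite}, 'm::finite) chamber"
  assumes i: "Suc i < CARD('m)"
  shows "panel_op i (panel_op i f) = (real CARD('a) - 1) *\<^sub>R panel_op i f + real CARD('a) *\<^sub>R f"
proof -
  have "panel_op i (panel_op i f) $ F
      = (real CARD('a) - 1) * (panel_op i f $ F) + real CARD('a) * f $ F" for F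
  proof -
    define P u g where "P = panel F i" and "u = mem F (Suc i)" and "g U = f $ replace F i U" for U
    have u: "u \<in> P" using mem_in_panel i by (simp add: P_def u_def)
    have gu: "g u = f $ F" using i by (simp add: g_def u_def replace_same)
    have "panel_op i (panel_op i f) $ F
        = (\<Sum>U\<in>P - {u}. \<Sum>U'\<in>P - {U}. g U')"
      unfolding panel_op_nth P_def u_def g_def using i
      by (intro sum.cong refl) (auto simp: panel_replace mem_replace replace_replace)
    also have "\<dots> = (\<Sum>U\<in>P - {u}. sum g P - g U)"
      by (intro sum.cong refl) (simp add: sum_diff1)
    also have "\<dots> = real (card (P - {u})) * sum g P - (sum g P - g u)"
      using u by (simp add: sum_subtractf sum_diff1)
    also have "real (card (P - {u})) = real CARD('a)"
      using u card_panel[OF i, of F] by (simp add: P_def)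
    also have "sum g P = panel_op i f $ F + g u"
      unfolding panel_op_nth P_def[symmetric] u_def[symmetric] g_def[symmetric] using u
      by (simp add: sum_diff1)
    finally show ?thesis by (simp add: gu algebra_simps)
  qed
  then show ?thesis by (simp add: vec_eq_iff)
qed

lemma panel_op_self_adjoint:
  fixes f g :: "real ^ ('a::{field,finite}, 'm::finite) chamber"
  assumes i: "Suc i < CARD('m)"
  shows "panel_op i f \<bullet> g = f \<bullet> panel_op i g"
proof -
  let ?S = "SIGMA F:UNIV. panel F i - {mem F (Suc i)}"
  have "panel_op i f \<bullet> g = (\<Sum>(F, U)\<in>?S. f $ replace F i U * g $ F)"
    by (simp add: inner_vec_def panel_op_nth sum_distrib_right sum.Sigma)
  also have "\<dots> = (\<Sum>(F, U)\<in>?S. f $ F * g $ replace F i U)"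
    using i
    by (intro sum.reindex_bij_witness[of _ "\<lambda>(F, U). (replace F i U, mem F (Suc i))"
          "\<lambda>(F, U). (replace F i U, mem F (Suc i))"])
      (auto simp: mem_replace panel_replace replace_replace replace_same mem_in_panel)
  also have "\<dots> = f \<bullet> panel_op i g"
    by (simp add: inner_vec_def panel_op_nth sum_distrib_left sum.Sigma)
  finally show ?thesis .
qed

lemma panel_op_commute:
  fixes f :: "real ^ ('a::{field,finite}, 'm::finite) chamber"
  assumes ij: "i + 1 < j" and j: "Suc j < CARD('m)"
  shows "panel_op i (panel_op j f) = panel_op j (panel_op i f)"
proof -
  have comm: "replace (replace F i U) j U' = replace (replace F j U') i U"
    if "U \<in> panel F i" "U' \<in> panel F j" for F :: "('a, 'm) chamber" and U U'
    by (rule chamber_eqI) (use that ij j in \<open>auto simp: mem_replace panel_replace\<close>)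
  have "panel_op i (panel_op j f) $ F = panel_op j (panel_op i f) $ F" for F
  proof -
    have "panel_op i (panel_op j f) $ F = (\<Sum>U\<in>panel F i - {mem F (Suc i)}.
        \<Sum>U'\<in>panel F j - {mem F (Suc j)}. f $ replace (replace F i U) j U')"
      unfolding panel_op_nth using ij j
      by (intro sum.cong refl) (auto simp: mem_replace panel_replace)
    also have "\<dots> = (\<Sum>U'\<in>panel F j - {mem F (Suc j)}.
        \<Sum>U\<in>panel F i - {mem F (Suc i)}. f $ replace (replace F j U') i U)"
      by (subst sum.swap) (auto intro!: sum.cong simp: comm)
    also have "\<dots> = panel_op j (panel_op i f) $ F"
      unfolding panel_op_nth using ij j
      by (intro sum.cong refl) (auto simp: mem_replace panel_replace)
    finally show ?thesis .
  qed
  then show ?thesis by (simp add: vec_eq_iff)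
qed

lemma dim_sum_inter:
  fixes U W :: "('a::field ^ 'm::finite) set"
  assumes "vec.subspace U" "vec.subspace W"
  shows "vec.dim (vec.span (U \<union> W)) + vec.dim (U \<inter> W) = vec.dim U + vec.dim W"
proof -
  have "vec.span U = U" "vec.span W = W" using assms vec.span_eq_iff by blast+
  then show ?thesis using vec.dim_sums_Int[OF assms] unfolding vec.span_Un by (simp only:)
qed

lemma dim_hyperplanes_inter:
  fixes U W :: "('a::field ^ 'm::finite) set"
  assumes "vec.subspace U" "vec.subspace W" "vec.subspace B" "U \<subseteq> B" "W \<subseteq> B" "U \<noteq> W"
    and "vec.dim U = Suc k" "vec.dim W = Suc k" "vec.dim B = Suc (Suc k)"
  shows "vec.dim (U \<inter> W) = k"
proof -
  have "vec.dim (vec.span (U \<union> W)) \<le> Suc (Suc k)"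
    using assms by (metis Un_least vec.dim_subset vec.span_minimal)
  moreover have "vec.dim (U \<inter> W) < Suc k"
  proof -
    have "U \<inter> W \<noteq> U" using assms subspace_eqI[of U W] by auto
    then show ?thesis using dim_psubset_less[of "U \<inter> W" U] assms vec.subspace_inter by auto
  qed
  ultimately show ?thesis using dim_sum_inter[of U W] assms by linarith
qed

lemma dim_covers_sum:
  fixes U W :: "('a::field ^ 'm::finite) set"
  assumes "vec.subspace U" "vec.subspace W" "vec.subspace A" "A \<subseteq> U" "A \<subseteq> W" "U \<noteq> W"
    and "vec.dim U = Suc k" "vec.dim W = Suc k" "vec.dim A = k"
  shows "vec.dim (vec.span (U \<union> W)) = Suc (Suc k)"
proof -
  have "vec.dim (U \<inter> W) \<ge> k"
    using assms by (metis Int_greatest vec.dim_subset)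
  moreover have "vec.dim (U \<inter> W) < Suc k"
  proof -
    have "U \<inter> W \<noteq> U" using assms subspace_eqI[of U W] by auto
    then show ?thesis using dim_psubset_less[of "U \<inter> W" U] assms vec.subspace_inter by auto
  qed
  ultimately show ?thesis using dim_sum_inter[of U W] assms by linarith
qed

text \<open>
Let \<open>A \<subset> p \<subset> l \<subset> B\<close> be the four members around the two positions concerned: a point and a line in the
projective plane \<open>B / A\<close>. Both sides sum over the galleries of length three from \<open>(p, l)\<close> to the pairs
\<open>(p', l')\<close>. For either order of the types there is exactly one such gallery if \<open>p \<notin> l'\<close> and \<open>p' \<notin> l\<close>, through the
intersection point of \<open>l\<close> and \<open>l'\<close> respectively the line joining \<open>p\<close> and \<open>p'\<close>, and none otherwise.
\<close>

lemma panel_op_braid: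
  fixes f :: "real ^ ('a::{field,finite}, 'm::finite) chamber"
  assumes i: "Suc (Suc i) < CARD('m)"
  shows "panel_op i (panel_op (Suc i) (panel_op i f)) = panel_op (Suc i) (panel_op i (panel_op (Suc i) f))"
proof -
  have "panel_op i (panel_op (Suc i) (panel_op i f)) $ F = panel_op (Suc i) (panel_op i (panel_op (Suc i) f)) $ F" for F
  proof -
    define A p l B where "A = mem F i" and "p = mem F (Suc i)" and "l = mem F (Suc (Suc i))"
      and "B = mem F (Suc (Suc (Suc i)))"
    have s: "vec.subspace A" "vec.subspace p" "vec.subspace l" "vec.subspace B"
      "vec.dim A = i" "vec.dim p = Suc i" "vec.dim l = Suc (Suc i)" "vec.dim B = Suc (Suc (Suc i))"
      "A \<subseteq> p" "p \<subseteq> l" "l \<subseteq> B"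
      using i mem_Suc[of F] by (simp_all add: A_def p_def l_def B_def)
    define seg where "seg U d W = {X :: ('a ^ 'm) set. vec.subspace X \<and> U \<subseteq> X \<and> X \<subseteq> W \<and> vec.dim X = d}" for U d W
    define h where "h p' l' = f $ chamber_of ((mem F)(Suc i := p', Suc (Suc i) := l'))" for p' l'
    define Z where "Z = {(p', l'). p' \<in> seg A (Suc i) l' \<and> l' \<in> seg A (Suc (Suc i)) B \<and> \<not> p \<subseteq> l' \<and> \<not> p' \<subseteq> l}"
    have r1: "f $ replace (replace (replace F i p1) (Suc i) l1) i p2 = h p2 l1"
      if "p1 \<in> panel F i" "l1 \<in> panel (replace F i p1) (Suc i)"
        "p2 \<in> panel (replace (replace F i p1) (Suc i) l1) i" for p1 l1 p2
    proof -
      have "mem (replace (replace (replace F i p1) (Suc i) l1) i p2)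
          = (mem F)(Suc i := p2, Suc (Suc i) := l1)"
        using that i by (auto simp: mem_replace fun_upd_twist)
      then show ?thesis unfolding h_def by (metis mem_inverse)
    qed
    have r2: "f $ replace (replace (replace F (Suc i) l1) i p1) (Suc i) l2 = h p1 l2"
      if "l1 \<in> panel F (Suc i)" "p1 \<in> panel (replace F (Suc i) l1) i"
        "l2 \<in> panel (replace (replace F (Suc i) l1) i p1) (Suc i)" for l1 p1 l2
    proof -
      have "mem (replace (replace (replace F (Suc i) l1) i p1) (Suc i) l2)
          = (mem F)(Suc i := p1, Suc (Suc i) := l2)"
        using that i by (auto simp: mem_replace)
      then show ?thesis unfolding h_def by (metis mem_inverse)
    qed
    have "panel_op i (panel_op (Suc i) (panel_op i f)) $ F
      = (\<Sum>p1\<in>seg A (Suc i) l - {p}. \<Sum>l1\<in>seg p1 (Suc (Suc i)) B - {l}. \<Sum>p2\<in>seg A (Suc i) l1 - {p1}. h p2 l1)"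
      unfolding panel_op_nth using i
      by (intro sum.cong refl)
         (auto simp: r1 panel_def seg_def mem_replace A_def p_def l_def B_def)
    also have "\<dots> = (\<Sum>(p1, l1, p2)\<in>(SIGMA p1:seg A (Suc i) l - {p}. SIGMA l1:seg p1 (Suc (Suc i)) B - {l}. seg A (Suc i) l1 - {p1}). h p2 l1)"
      by (simp add: sum.Sigma)
    also have "\<dots> = (\<Sum>(p', l')\<in>Z. h p' l')"
    proof (rule sum.reindex_bij_witness[of _ "\<lambda>(p', l'). (l \<inter> l', l', p')" "\<lambda>(p1, l1, p2). (p2, l1)"])
      fix a assume "a \<in> (SIGMA p1:seg A (Suc i) l - {p}. SIGMA l1:seg p1 (Suc (Suc i)) B - {l}. seg A (Suc i) l1 - {p1})"
      then obtain p1 l1 p2 where a: "a = (p1, l1, p2)" "p1 \<in> seg A (Suc i) l" "p1 \<noteq> p"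
        "l1 \<in> seg p1 (Suc (Suc i)) B" "l1 \<noteq> l" "p2 \<in> seg A (Suc i) l1" "p2 \<noteq> p1" by auto
      have "vec.dim (l \<inter> l1) = Suc i"
        using a s by (intro dim_hyperplanes_inter[of _ _ B]) (auto simp: seg_def)
      then have p1: "p1 = l \<inter> l1"
        using a s by (intro subspace_eqI) (auto simp: seg_def vec.subspace_inter)
      have "\<not> p \<subseteq> l1"
        using a s subspace_eqI[of p p1] p1 by (auto simp: seg_def)
      moreover have "\<not> p2 \<subseteq> l"
        using a s subspace_eqI[of p2 p1] p1 by (auto simp: seg_def)
      ultimately show "(case a of (p1, l1, p2) \<Rightarrow> (p2, l1)) \<in> Z"
        using a unfolding Z_def by (auto simp: seg_def)
      show "(case case a of (p1, l1, p2) \<Rightarrow> (p2, l1) of (p', l') \<Rightarrow> (l \<inter> l', l', p')) = a"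
        using p1 a by simp
    next
      fix b assume "b \<in> Z"
      then obtain p' l' where b: "b = (p', l')" "p' \<in> seg A (Suc i) l'" "l' \<in> seg A (Suc (Suc i)) B"
        "\<not> p \<subseteq> l'" "\<not> p' \<subseteq> l" by (auto simp: Z_def)
      have "vec.dim (l \<inter> l') = Suc i"
        using b s by (intro dim_hyperplanes_inter[of _ _ B]) (auto simp: seg_def)
      then show "(case b of (p', l') \<Rightarrow> (l \<inter> l', l', p')) \<in>
        (SIGMA p1:seg A (Suc i) l - {p}. SIGMA l1:seg p1 (Suc (Suc i)) B - {l}. seg A (Suc i) l1 - {p1})"
        using b s by (auto simp: seg_def vec.subspace_inter)
      show "(case case b of (p', l') \<Rightarrow> (l \<inter> l', l', p') of (p1, l1, p2) \<Rightarrow> (p2, l1)) = b"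
        using b by simp
    qed auto
    also have "\<dots> = (\<Sum>(l1, p1, l2)\<in>(SIGMA l1:seg p (Suc (Suc i)) B - {l}. SIGMA p1:seg A (Suc i) l1 - {p}. seg p1 (Suc (Suc i)) B - {l1}). h p1 l2)"
    proof (rule sum.reindex_bij_witness[of _ "\<lambda>(l1, p1, l2). (p1, l2)" "\<lambda>(p', l'). (vec.span (p \<union> p'), p', l')"])
      fix a assume "a \<in> (SIGMA l1:seg p (Suc (Suc i)) B - {l}. SIGMA p1:seg A (Suc i) l1 - {p}. seg p1 (Suc (Suc i)) B - {l1})"
      then obtain l1 p1 l2 where a: "a = (l1, p1, l2)" "l1 \<in> seg p (Suc (Suc i)) B" "l1 \<noteq> l"
        "p1 \<in> seg A (Suc i) l1" "p1 \<noteq> p" "l2 \<in> seg p1 (Suc (Suc i)) B" "l2 \<noteq> l1" by auto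
      have "vec.dim (vec.span (p \<union> p1)) = Suc (Suc i)"
        using a s by (intro dim_covers_sum[of _ _ A]) (auto simp: seg_def)
      then have sp: "X = vec.span (p \<union> p1)"
        if "vec.subspace X" "vec.dim X = Suc (Suc i)" "p \<subseteq> X" "p1 \<subseteq> X" for X
        using that subspace_eqI[of "vec.span (p \<union> p1)" X] vec.span_minimal[of "p \<union> p1" X] by auto
      have l1: "l1 = vec.span (p \<union> p1)"
        using sp[of l1] a by (simp add: seg_def)
      have "\<not> p \<subseteq> l2"
        using sp[of l2] a l1 by (auto simp: seg_def)
      moreover have "\<not> p1 \<subseteq> l"
        using sp[of l] a l1 s by auto
      ultimately show "(case a of (l1, p1, l2) \<Rightarrow> (p1, l2)) \<in> Z"
        using a unfolding Z_def by (auto simp: seg_def)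
      show "(case case a of (l1, p1, l2) \<Rightarrow> (p1, l2) of (p', l') \<Rightarrow> (vec.span (p \<union> p'), p', l')) = a"
        using l1 a by simp
    next
      fix b assume "b \<in> Z"
      then obtain p' l' where b: "b = (p', l')" "p' \<in> seg A (Suc i) l'" "l' \<in> seg A (Suc (Suc i)) B"
        "\<not> p \<subseteq> l'" "\<not> p' \<subseteq> l" by (auto simp: Z_def)
      have "p \<noteq> p'" using b s by auto
      then have "vec.dim (vec.span (p \<union> p')) = Suc (Suc i)"
        using b s by (intro dim_covers_sum[of _ _ A]) (auto simp: seg_def)
      moreover have "p \<union> p' \<subseteq> vec.span (p \<union> p')" by (rule vec.span_superset)
      moreover have "vec.span (p \<union> p') \<subseteq> B" using b s by (intro vec.span_minimal) (auto simp: seg_def)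
      ultimately show "(case b of (p', l') \<Rightarrow> (vec.span (p \<union> p'), p', l')) \<in>
        (SIGMA l1:seg p (Suc (Suc i)) B - {l}. SIGMA p1:seg A (Suc i) l1 - {p}. seg p1 (Suc (Suc i)) B - {l1})"
        using b s by (auto simp: seg_def)
      show "(case case b of (p', l') \<Rightarrow> (vec.span (p \<union> p'), p', l') of (l1, p1, l2) \<Rightarrow> (p1, l2)) = b"
        using b by simp
    qed auto
    also have "\<dots> = (\<Sum>l1\<in>seg p (Suc (Suc i)) B - {l}. \<Sum>p1\<in>seg A (Suc i) l1 - {p}. \<Sum>l2\<in>seg p1 (Suc (Suc i)) B - {l1}. h p1 l2)"
      by (simp add: sum.Sigma)
    also have "\<dots> = panel_op (Suc i) (panel_op i (panel_op (Suc i) f)) $ F"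
      unfolding panel_op_nth using i
      by (intro sum.cong refl)
         (auto simp: r2 panel_def seg_def mem_replace A_def p_def l_def B_def)
    finally show ?thesis .
  qed
  then show ?thesis by (simp add: vec_eq_iff)
qed

lemma chamber_refining:
  fixes F :: "('a::field, 'm::finite) chamber"
  assumes "vec.subspace K" "vec.dim K = j" "K \<subseteq> mem F (Suc j)" "j < CARD('m)"
  obtains F' where "mem F' j = K" "\<And>i. j < i \<Longrightarrow> mem F' i = mem F i"
proof -
  obtain c where c: "\<And>i. vec.subspace (c i)" "\<And>i. c i \<subseteq> c (Suc i)"
    "\<And>i. vec.dim (c i) = min i j" "c j = K"
    using chain_below[OF assms(1,2)] by blast
  define d where "d i = (if i \<le> j then c i else mem F i)" for i
  have "vec.subspace (d i)" "d i \<subseteq> d (Suc i)" "vec.dim (d i) = min i CARD('m)" for i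
  proof -
    show "d i \<subseteq> d (Suc i)"
      using c(2)[of i] c(4) assms(3) mem_Suc[of F i] by (cases "i = j") (auto simp: d_def)
  qed (use c assms in \<open>auto simp: d_def dim_mem\<close>)
  then have "mem (chamber_of d) = d" by (intro chamber_of_inverse) auto
  then show ?thesis using that[of "chamber_of d"] c by (simp add: d_def)
qed

interpretation hecke: hecke_representation "real CARD('a)" "CARD('m) - 1"
  "panel_op :: nat \<Rightarrow> real ^ ('a::{field,finite}, 'm::finite) chamber \<Rightarrow> real ^ ('a, 'm) chamber"
proof (rule hecke_representation.intro)
  have "card {0, 1 :: 'a} \<le> CARD('a)" by (intro card_mono) auto
  then show "real CARD('a) > 1" by simp
next
  fix i assume "i < CARD('m) - 1"
  show "linear (panel_op i :: real ^ ('a, 'm) chamber \<Rightarrow> real ^ ('a, 'm) chamber)" by (rule panel_op_linear)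
qed (auto simp: panel_op_self_adjoint panel_op_quadratic panel_op_braid intro!: panel_op_commute)

lemma panel_op_const:
  assumes "Suc i < CARD('m)"
  shows "panel_op i (\<chi> F. c) = real CARD('a) *\<^sub>R (\<chi> F. c :: real ^ ('a::{field,finite}, 'm::finite) chamber)"
  using card_panel[OF assms, where ?'a = 'a] mem_in_panel[OF assms, where ?'a = 'a]
  by (simp add: vec_eq_iff panel_op_nth card_Diff_singleton)

lemma fixed_replace:
  fixes f :: "real ^ ('a::{field,finite}, 'm::finite) chamber"
  assumes i: "Suc i < CARD('m)" and f: "panel_op i f = real CARD('a) *\<^sub>R f" and U: "U \<in> panel F i"
  shows "f $ replace F i U = f $ F"
proof -
  have *: "(\<Sum>U\<in>panel F i. f $ replace F i U) = (real CARD('a) + 1) * f $ F" for F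
  proof -
    have "(\<Sum>U\<in>panel F i. f $ replace F i U) = panel_op i f $ F + f $ F"
      using mem_in_panel[OF i, of F] i by (simp add: panel_op_nth sum_diff1 replace_same)
    then show ?thesis by (simp add: f algebra_simps)
  qed
  have "(\<Sum>U'\<in>panel (replace F i U) i. f $ replace (replace F i U) i U') = (\<Sum>U'\<in>panel F i. f $ replace F i U')"
    using i U by (intro sum.cong) (auto simp: panel_replace replace_replace)
  then have "(real CARD('a) + 1) * f $ replace F i U = (real CARD('a) + 1) * f $ F"
    by (simp only: *)
  moreover have "real CARD('a) + 1 \<noteq> 0" by linarith
  ultimately show ?thesis by simp
qed

text \<open>
A fixed function takes the same value on all chambers of a panel, so the claim is that the chamber system
is connected. If two chambers agree above dimension \<open>k\<close> but have different members \<open>F\<^sub>k\<close> and \<open>G\<^sub>k\<close>, first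
move the member below \<open>F\<^sub>k\<close> to \<open>F\<^sub>k \<inter> G\<^sub>k\<close> (by induction); then \<open>F\<^sub>k\<close> can be exchanged for \<open>G\<^sub>k\<close>.
\<close>

lemma fixed_constant:
  fixes f :: "real ^ ('a::{field,finite}, 'm::finite) chamber"
  assumes f: "f \<in> hecke.fixed (CARD('m) - 1)"
  shows "f $ F = f $ G"
proof -
  have fr: "f $ replace F i U = f $ F" if "Suc i < CARD('m)" "U \<in> panel F i" for F i U
    using fixed_replace[of i f U F] f that by (auto simp: hecke.fixed_def)
  have "f $ F = f $ G" if "\<And>i. k \<le> i \<Longrightarrow> mem F i = mem G i" "k \<le> CARD('m)" for k F G
    using that
  proof (induction k arbitrary: F G)
    case 0
    then have "F = G" by (intro chamber_eqI) auto
    then show ?case by simp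
  next
    case (Suc k)
    show ?case
    proof (cases "k = 0 \<or> mem F k = mem G k")
      case True
      show ?thesis
      proof (rule Suc.IH)
        show "mem F i = mem G i" if "k \<le> i" for i
          using Suc.prems(1)[of i] True that by (cases "i = k") auto
      qed (use Suc.prems in simp)
    next
      case False
      then obtain j where j: "k = Suc j" by (cases k) auto
      let ?K = "mem F k \<inter> mem G k"
      have K: "vec.subspace ?K" "vec.dim ?K = j"
        using False j Suc.prems mem_Suc[of F k] mem_Suc[of G k]
        by (auto intro!: vec.subspace_inter dim_hyperplanes_inter[of _ _ "mem F (Suc k)"])
      have kG: "mem F i = mem G i" if "k < i" for i using Suc.prems that by simp
      obtain F' where F': "mem F' j = ?K" "\<And>i. j < i \<Longrightarrow> mem F' i = mem F i"
        using chamber_refining[OF K, of F] j Suc.prems by auto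
      have pan: "mem G k \<in> panel F' j"
        using F' j Suc.prems mem_Suc[of G k] by (auto simp: panel_def)
      have "f $ F = f $ F'"
        by (rule Suc.IH) (use F' j Suc.prems in auto)
      also have "\<dots> = f $ replace F' j (mem G k)"
        using fr[of j "mem G k" F'] pan j Suc.prems by auto
      also have "\<dots> = f $ G"
      proof (rule Suc.IH)
        show "mem (replace F' j (mem G k)) i = mem G i" if "k \<le> i" for i
          using that pan F' j Suc.prems kG by (auto simp: mem_replace)
      qed (use Suc.prems in simp)
      finally show ?thesis .
    qed
  qed
  from this[of "CARD('m)" F G] show ?thesis by (simp add: mem_full)
qed

section \<open>Opposition\<close>

lemma panel_op_support:
  assumes "panel_op i f $ F \<noteq> 0"
  obtains U where "U \<in> panel F i" "U \<noteq> mem F (Suc i)" "f $ replace F i U \<noteq> 0"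
  using assms unfolding panel_op_nth by (metis DiffE singletonI sum.not_neutral_contains_not_neutral)

text \<open>
Such a chamber \<open>G\<close> arises by exchanging successively the members of dimension \<open>1, \<dots>, k\<close>; geometrically,
\<open>mem G k\<close> is a hyperplane of \<open>mem F (k + 1)\<close> that misses the point \<open>mem F 1\<close>, and cuts out the other members.
\<close>

lemma coxeter_support:
  fixes f :: "real ^ ('a::{field,finite}, 'm::finite) chamber"
  assumes "hecke.coxeter k f $ F \<noteq> 0" "k < CARD('m)"
  shows "\<exists>G. f $ G \<noteq> 0 \<and> (\<forall>i>k. mem G i = mem F i) \<and> (\<forall>i\<le>k. mem G i \<subseteq> mem F (Suc i)) \<and>
      \<not> mem F 1 \<subseteq> mem G k"
  using assms
proof (induction k arbitrary: f)
  case 0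
  have "\<not> mem F 1 \<subseteq> mem F 0"
    using vec.dim_subset[of "mem F 1" "mem F 0"] 0 by (auto simp: dim_mem)
  then show ?case using 0 by (intro exI[of _ F]) auto
next
  case (Suc k)
  obtain G where G: "panel_op k f $ G \<noteq> 0" "\<And>i. i > k \<Longrightarrow> mem G i = mem F i"
    "\<And>i. i \<le> k \<Longrightarrow> mem G i \<subseteq> mem F (Suc i)" "\<not> mem F 1 \<subseteq> mem G k"
    using Suc.IH[of "panel_op k f"] Suc.prems by auto
  obtain U where U: "U \<in> panel G k" "U \<noteq> mem G (Suc k)" "f $ replace G k U \<noteq> 0"
    using panel_op_support G(1) by blast
  have mU: "mem (replace G k U) = (mem G)(Suc k := U)" using U Suc.prems by (intro mem_replace) auto
  have "U \<inter> mem G (Suc k) = mem G k"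
  proof (rule subspace_eqI[symmetric])
    have "vec.dim (U \<inter> mem G (Suc k)) = k"
      using U Suc.prems mem_Suc[of G "Suc k"]
      by (intro dim_hyperplanes_inter[of _ _ "mem G (Suc (Suc k))"]) (auto simp: panel_def)
    then show "vec.dim (U \<inter> mem G (Suc k)) \<le> vec.dim (mem G k)" using Suc.prems by simp
  qed (use U mem_Suc[of G k] in \<open>auto simp: panel_def intro: vec.subspace_inter\<close>)
  moreover have "mem F 1 \<subseteq> mem G (Suc k)" using G(2)[of "Suc k"] mem_mono[of 1 "Suc k" F] by simp
  ultimately have "\<not> mem F 1 \<subseteq> U" using G(4) by blast
  moreover have "U \<subseteq> mem F (Suc (Suc k))" using U G(2)[of "Suc (Suc k)"] by (auto simp: panel_def)
  ultimately show ?case using U(3) mU G(2,3)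
    by (intro exI[of _ "replace G k U"]) (auto simp: le_Suc_eq)
qed

text \<open>
For \<open>k = n + 1\<close> this is the geometric form of opposition; smaller \<open>k\<close> describe opposition inside a common
member of dimension \<open>k\<close>, as needed for induction.
\<close>

definition transversal :: "nat \<Rightarrow> ('a::field, 'm::finite) chamber \<Rightarrow> ('a, 'm) chamber \<Rightarrow> bool" where
  "transversal k F G \<longleftrightarrow> (\<forall>i\<le>k. mem F i \<inter> mem G (k - i) = {0})"

lemma longest_support:
  fixes f :: "real ^ ('a::{field,finite}, 'm::finite) chamber"
  assumes "hecke.longest k f $ F \<noteq> 0" "k < CARD('m)"
  shows "\<exists>G. f $ G \<noteq> 0 \<and> (\<forall>i>k. mem G i = mem F i) \<and> transversal (Suc k) F G"
  using assms
proof (induction k arbitrary: F)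
  case 0
  then show ?case by (intro exI[of _ F]) (auto simp: transversal_def le_Suc_eq)
next
  case (Suc k)
  obtain F' where F': "hecke.longest k f $ F' \<noteq> 0" "\<And>i. i > Suc k \<Longrightarrow> mem F' i = mem F i"
    "\<And>i. i \<le> Suc k \<Longrightarrow> mem F' i \<subseteq> mem F (Suc i)" "\<not> mem F 1 \<subseteq> mem F' (Suc k)"
    using coxeter_support[of "Suc k" "hecke.longest k f" F] Suc.prems by auto
  obtain G where G: "f $ G \<noteq> 0" "\<And>i. i > k \<Longrightarrow> mem G i = mem F' i" "transversal (Suc k) F' G"
    using Suc.IH[OF F'(1)] Suc.prems by auto
  \<comment> \<open>\<open>mem F' (Suc k)\<close> is a hyperplane of \<open>mem F (Suc (Suc k))\<close> that misses the point \<open>mem F 1\<close>.\<close>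
  have cut: "mem F (Suc j) \<inter> mem F' (Suc k) = mem F' j" if j: "j \<le> Suc k" for j
  proof (rule subspace_eqI[symmetric])
    have "mem F (Suc j) \<inter> mem F' (Suc k) \<noteq> mem F (Suc j)"
      using F'(4) mem_mono[of 1 "Suc j" F] by auto
    then have "vec.dim (mem F (Suc j) \<inter> mem F' (Suc k)) < vec.dim (mem F (Suc j))"
      by (intro dim_psubset_less) (auto intro: vec.subspace_inter)
    then show "vec.dim (mem F (Suc j) \<inter> mem F' (Suc k)) \<le> vec.dim (mem F' j)"
      using j Suc.prems by (simp add: dim_mem)
    show "mem F' j \<subseteq> mem F (Suc j) \<inter> mem F' (Suc k)"
      using F'(3)[OF j] mem_mono[OF j, of F'] by simp
  qed (auto intro: vec.subspace_inter)
  have "mem F i \<inter> mem G (Suc (Suc k) - i) = {0}" if i: "i \<le> Suc (Suc k)" for i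
  proof (cases i)
    case (Suc j)
    have "mem G (Suc k - j) \<subseteq> mem F' (Suc k)"
      using mem_mono[of "Suc k - j" "Suc k" G] G(2)[of "Suc k"] by simp
    then have "mem F (Suc j) \<inter> mem G (Suc k - j) \<subseteq> mem F' j \<inter> mem G (Suc k - j)"
      using cut[of j] i Suc by auto
    also have "\<dots> = {0}" using G(3) i Suc by (auto simp: transversal_def)
    finally show ?thesis using Suc by auto
  qed auto
  then show ?case using G(1,2) F'(2) by (intro exI[of _ G]) (auto simp: transversal_def)
qed

section \<open>The ratio bound for chambers\<close>

text \<open>
If \<open>x\<close> is the indicator function of \<open>C\<close> and \<open>y\<close> its component orthogonal to the constants, then
\<open>0 = x \<bullet> T\<^sub>w\<^sub>0 x = q\<^sup>N c\<^sup>2 / v + y \<bullet> T\<^sub>w\<^sub>0 y\<close>, and the last term is at least \<open>- q\<^sup>N |y|\<^sup>2 / r\<close> with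
\<open>|y|\<^sup>2 = c - c\<^sup>2 / v\<close>.
\<close>

theorem chamber_EKR_bound:
  fixes C :: "('a::{field,finite}, 'm::finite) chamber set"
  assumes C: "\<And>F G. F \<in> C \<Longrightarrow> G \<in> C \<Longrightarrow> \<not> transversal CARD('m) F G"
  shows "real (card C) * (1 + real CARD('a) powr (real CARD('m) / 2)) \<le> real CARD(('a, 'm) chamber)"
proof -
  define n q where "n = CARD('m) - 1" and "q = real CARD('a)"
  have m: "CARD('m) = Suc n" by (simp add: n_def)
  have q: "q > 1" unfolding q_def by (rule hecke.q)
  define c v r where "c = real (card C)" and "v = real CARD(('a, 'm) chamber)"
    and "r = q powr (real CARD('m) / 2)"
  have "r\<^sup>2 = q powr real CARD('m)" by (simp add: r_def power2_eq_square powr_add[symmetric])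
  then have r: "r > 0" "r\<^sup>2 = q ^ (n + 1)"
    using q powr_realpow[of q "CARD('m)"] by (simp_all add: r_def m)
  have v: "v > 0" by (simp add: v_def)
  define x e y :: "real ^ ('a, 'm) chamber" where "x = (\<chi> F. if F \<in> C then 1 else 0)"
    and "e = (\<chi> F. 1)" and "y = x - (c / v) *\<^sub>R e"
  define W where "W = (hecke.longest n :: real ^ ('a, 'm) chamber \<Rightarrow> _)"
  interpret W: linear W unfolding W_def by (rule hecke.linear_longest) (simp add: n_def)
  have ee: "e \<bullet> e = v" "e \<bullet> x = c" "x \<bullet> x = c"
    by (simp_all add: inner_vec_def e_def x_def v_def c_def if_distrib sum.If_cases cong: if_cong)
  have ey: "e \<bullet> y = 0" using v by (simp add: y_def inner_diff_right ee)
  have yy: "y \<bullet> y = c - c\<^sup>2 / v"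
    using v ey by (simp add: y_def inner_diff_right inner_diff_left ee inner_commute[of x e] power2_eq_square)
  have e_fixed: "e \<in> hecke.fixed n"
    by (auto simp: hecke.fixed_def e_def panel_op_const m)
  have We: "W e = q ^ hecke.longest_length n *\<^sub>R e"
    using hecke.longest_fixed[of n e] e_fixed unfolding W_def q_def by (simp add: n_def)
  have y: "y \<in> hecke.cofixed n"
    unfolding hecke.cofixed_def
  proof safe
    fix w :: "real ^ ('a, 'm) chamber" assume w: "w \<in> hecke.fixed n"
    obtain F :: "('a, 'm) chamber" where True by simp
    have "w = (w $ F) *\<^sub>R e" using fixed_constant[of w _ F] w by (simp add: vec_eq_iff e_def n_def)
    then show "y \<bullet> w = 0" using ey by (metis inner_commute inner_scaleR_right mult_zero_right)
  qed
  have "W y \<in> hecke.cofixed n"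
    unfolding W_def using y by (intro hecke.longest_cofixed) (auto simp: n_def)
  then have eWy: "e \<bullet> W y = 0" using e_fixed by (simp add: hecke.cofixed_def inner_commute)
  have gap: "r * norm (W y) \<le> q ^ hecke.longest_length n * norm y"
  proof (rule power2_le_imp_le)
    have "q ^ (n + 1) * (W y \<bullet> W y) \<le> q ^ (2 * hecke.longest_length n) * (y \<bullet> y)"
      using hecke.longest_gap[of n y] y unfolding W_def q_def by (simp add: n_def)
    then show "(r * norm (W y))\<^sup>2 \<le> (q ^ hecke.longest_length n * norm y)\<^sup>2"
      by (simp add: power_mult_distrib r dot_square_norm power_mult[symmetric] mult.commute)
  qed (use q in simp)
  have "x \<bullet> W x = 0"
  proof -
    have "x $ F * W x $ F = 0" for F
    proof (rule ccontr)
      assume "x $ F * W x $ F \<noteq> 0"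
      then have "F \<in> C" "hecke.longest n x $ F \<noteq> 0" by (auto simp: x_def W_def split: if_splits)
      then obtain G where "x $ G \<noteq> 0" "transversal (Suc n) F G"
        using longest_support[of n x F] m by auto
      then show False using C[of F G] \<open>F \<in> C\<close> m by (auto simp: x_def split: if_splits)
    qed
    then show ?thesis unfolding inner_vec_def by (intro sum.neutral) auto
  qed
  moreover have "x = y + (c / v) *\<^sub>R e" by (simp add: y_def)
  ultimately have "0 = y \<bullet> W y + (c / v)\<^sup>2 * q ^ hecke.longest_length n * v"
    using ey eWy v by (simp add: W.add W.scale We inner_add_left inner_add_right ee inner_commute[of y e] power2_eq_square mult_ac)
  also have "(c / v)\<^sup>2 * q ^ hecke.longest_length n * v = q ^ hecke.longest_length n * (c\<^sup>2 / v)"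
    using v by (simp add: power2_eq_square)
  finally have "q ^ hecke.longest_length n * (c\<^sup>2 / v) = - (y \<bullet> W y)" by simp
  also have "\<dots> \<le> norm y * norm (W y)" using Cauchy_Schwarz_ineq2[of y "W y"] by linarith
  finally have "q ^ hecke.longest_length n * (c\<^sup>2 / v) * r \<le> norm y * norm (W y) * r"
    using r by (intro mult_right_mono) auto
  also have "\<dots> = norm y * (r * norm (W y))" by simp
  also have "\<dots> \<le> norm y * (q ^ hecke.longest_length n * norm y)"
    by (intro mult_left_mono gap) simp
  also have "\<dots> = q ^ hecke.longest_length n * (c - c\<^sup>2 / v)"
    using yy by (simp add: dot_square_norm power2_eq_square)
  finally have "q ^ hecke.longest_length n * (c\<^sup>2 / v * r) \<le> q ^ hecke.longest_length n * (c - c\<^sup>2 / v)" by (simp add: mult_ac)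
  moreover have "q ^ hecke.longest_length n > 0" using q by simp
  ultimately have "c\<^sup>2 / v * r \<le> c - c\<^sup>2 / v" by (rule mult_left_le_imp_le)
  then have "c * (c * (1 + r)) \<le> c * v" using v by (simp add: field_simps power2_eq_square)
  moreover have "c \<ge> 0" by (simp add: c_def)
  ultimately have "c * (1 + r) \<le> v" using v by (cases "c = 0") auto
  then show ?thesis by (simp add: c_def v_def r_def q_def)
qed

section \<open>Frames and the Bruhat decomposition\<close>

definition frame :: "(nat \<Rightarrow> 'a::field ^ 'm::finite) \<Rightarrow> ('a, 'm) chamber \<Rightarrow> bool" where
  "frame b F \<longleftrightarrow> (\<forall>i\<in>{1..CARD('m)}. b i \<in> mem F i \<and> b i \<notin> mem F (i - 1))"

lemma frame_span:
  fixes F :: "('a::field, 'm::finite) chamber"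
  assumes "frame b F" "i \<le> CARD('m)"
  shows "mem F i = vec.span (b ` {1..i})"
  using assms(2)
proof (induction i)
  case (Suc i)
  have ins: "b ` {1..Suc i} = insert (b (Suc i)) (b ` {1..i})" by (simp add: atLeastAtMostSuc_conv)
  have sub: "b ` {1..Suc i} \<subseteq> mem F (Suc i)"
  proof safe
    fix j assume "j \<in> {1..Suc i}"
    then show "b j \<in> mem F (Suc i)"
      using assms(1) Suc.prems mem_mono[of j "Suc i" F] by (auto simp: frame_def)
  qed
  have "b (Suc i) \<notin> vec.span (b ` {1..i})"
    using assms(1) Suc by (force simp: frame_def)
  then have "vec.dim (vec.span (b ` {1..Suc i})) = Suc i"
    using Suc by (metis Suc_eq_plus1 Suc_leD dim_mem_less ins vec.dim_insert vec.dim_span)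
  then show ?case
    using Suc.prems sub by (intro subspace_eqI[symmetric] vec.span_minimal) auto
qed simp

text \<open>
Let \<open>w k\<close> be the first \<open>j\<close> for which \<open>F\<^sub>j \<inter> G\<^sub>k\<close> is not contained in \<open>G\<^sub>k\<^sub>-\<^sub>1\<close>, and choose a vector \<open>c k\<close> showing
this. By minimality it is not in \<open>F\<^sub>j\<^sub>-\<^sub>1\<close>. If \<open>w k = w l = j\<close> with \<open>k < l\<close>, then some \<open>c l - a c k\<close> lies
in \<open>F\<^sub>j\<^sub>-\<^sub>1\<close>, hence in \<open>G\<^sub>l\<^sub>-\<^sub>1\<close> by minimality, and so does \<open>c l\<close>, a contradiction. Thus \<open>w\<close> is a permutation.
\<close>

lemma adapted_frame:
  fixes F G :: "('a::field, 'm::finite) chamber"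
  obtains w b where "w permutes {1..CARD('m)}" "frame b F" "frame (b \<circ> w) G"
proof -
  let ?N = "CARD('m)"
  define P where "P k j \<longleftrightarrow> \<not> mem F j \<inter> mem G k \<subseteq> mem G (k - 1)" for k j
  define w0 where "w0 k = (LEAST j. P k j)" for k
  have P: "P k (w0 k)" and w0: "w0 k \<in> {1..?N}" if k: "k \<in> {1..?N}" for k
  proof -
    have "P k ?N"
      unfolding P_def
    proof
      assume "mem F ?N \<inter> mem G k \<subseteq> mem G (k - 1)"
      then have "mem G k \<subseteq> mem G (k - 1)" by (simp add: mem_full)
      then show False using vec.dim_subset[of "mem G k" "mem G (k - 1)"] k by auto
    qed
    then show Pk: "P k (w0 k)" and "w0 k \<in> {1..?N}"
    proof -
      assume "P k ?N"
      then show Pk: "P k (w0 k)" unfolding w0_def by (rule LeastI)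
      have "\<not> P k 0" by (simp add: P_def)
      then have "w0 k \<noteq> 0" using Pk by metis
      moreover have "w0 k \<le> ?N" unfolding w0_def using \<open>P k ?N\<close> by (rule Least_le)
      ultimately show "w0 k \<in> {1..?N}" by simp
    qed
  qed
  \<comment> \<open>This is the minimality of \<open>w0 k\<close>.\<close>
  have below: "mem F (w0 k - 1) \<inter> mem G k \<subseteq> mem G (k - 1)" if "k \<in> {1..?N}" for k
    using not_less_Least[of "w0 k - 1" "P k"] w0[OF that] by (auto simp: w0_def P_def)
  define c where "c k = (SOME x. x \<in> mem F (w0 k) \<and> x \<in> mem G k \<and> x \<notin> mem G (k - 1))" for k
  have c: "c k \<in> mem F (w0 k)" "c k \<in> mem G k" "c k \<notin> mem G (k - 1)" "c k \<notin> mem F (w0 k - 1)"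
    if k: "k \<in> {1..?N}" for k
  proof -
    have "\<exists>x. x \<in> mem F (w0 k) \<and> x \<in> mem G k \<and> x \<notin> mem G (k - 1)"
      using P[OF k] by (auto simp: P_def)
    from someI_ex[OF this] show *: "c k \<in> mem F (w0 k)" "c k \<in> mem G k" "c k \<notin> mem G (k - 1)"
      by (auto simp: c_def)
    then show "c k \<notin> mem F (w0 k - 1)" using below[OF k] by auto
  qed
  have no_clash: False if kl: "k \<in> {1..?N}" "l \<in> {1..?N}" "k < l" "w0 k = w0 l" for k l
  proof -
    let ?j = "w0 l - 1"
    have j: "w0 l = Suc ?j" "Suc ?j \<le> ?N" using w0[OF kl(2)] by auto
    have "c k \<in> mem F (Suc ?j)" "c k \<notin> mem F ?j" using c[OF kl(1)] kl(4) j by auto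
    then have "vec.span (insert (c k) (mem F ?j)) = mem F (Suc ?j)"
      using j(2) mem_Suc[of F ?j]
      by (intro subspace_eqI vec.span_minimal) (auto simp: dim_insert_subspace)
    then obtain a where a: "c l - a *s c k \<in> mem F ?j"
      using c(1)[OF kl(2)] j(1) vec.span_breakdown_eq[of "c l" "c k" "mem F ?j"]
      by auto
    have "mem G k \<subseteq> mem G (l - 1)" using kl(3) by (intro mem_mono) simp
    then have ck: "a *s c k \<in> mem G (l - 1)"
      using c(2)[OF kl(1)] by (intro vec.subspace_scale) auto
    then have "a *s c k \<in> mem G l" using mem_mono[of "l - 1" l G] by auto
    then have "c l - a *s c k \<in> mem G (l - 1)"
      using a below[OF kl(2)] c(2)[OF kl(2)] vec.subspace_diff[of "mem G l"] by auto
    then have "(c l - a *s c k) + a *s c k \<in> mem G (l - 1)" using ck by (intro vec.subspace_add) auto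
    then show False using c(3)[OF kl(2)] by simp
  qed
  have inj: "inj_on w0 {1..?N}"
  proof (rule inj_onI)
    fix k l assume "k \<in> {1..?N}" "l \<in> {1..?N}" "w0 k = w0 l"
    then show "k = l" using no_clash[of k l] no_clash[of l k] by (cases k l rule: linorder_cases) auto
  qed
  define w where "w k = (if k \<in> {1..?N} then w0 k else k)" for k
  have ww0: "w k = w0 k" if "k \<in> {1..?N}" for k
    unfolding w_def using that by (rule if_P)
  have bij: "bij_betw w {1..?N} {1..?N}"
  proof -
    have "inj_on w {1..?N}" using inj inj_on_cong[of "{1..?N}" w w0] ww0 by blast
    moreover have "w ` {1..?N} \<subseteq> {1..?N}" using w0 ww0 by (metis image_subsetI)
    ultimately show ?thesis unfolding bij_betw_def using endo_inj_surj[of "{1..?N}" w] by blast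
  qed
  then have perm: "w permutes {1..?N}" by (rule bij_imp_permutes) (metis w_def)
  define b where "b = c \<circ> inv_into UNIV w"
  have bw: "b \<circ> w = c" using permutes_inv_o(2)[OF perm] by (simp add: b_def comp_assoc)
  have "frame b F"
    unfolding frame_def
  proof
    fix i assume "i \<in> {1..?N}"
    then obtain k where k: "k \<in> {1..?N}" "i = w k" using bij unfolding bij_betw_def by blast
    have "b i = c k" using fun_cong[OF bw, of k] unfolding k(2) comp_def .
    moreover have "i = w0 k" using k ww0 by blast
    ultimately show "b i \<in> mem F i \<and> b i \<notin> mem F (i - 1)" using c[OF k(1)] by metis
  qed
  moreover have "frame (b \<circ> w) G" unfolding bw frame_def using c by blast
  ultimately show ?thesis using that perm by blast
qed

text \<open>
The vector \<open>b (w k)\<close> lies in \<open>F\<^sub>w\<^sub>k \<inter> G\<^sub>k\<close>, so transversality forces \<open>w k + k > n + 1\<close> for all \<open>k\<close>. Since \<open>w\<close> is a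
permutation, both sides of \<open>w k \<ge> n + 2 - k\<close> have the same sum, and equality holds throughout.
\<close>

lemma transversal_adapted:
  fixes F G :: "('a::field, 'm::finite) chamber"
  assumes w: "w permutes {1..CARD('m)}" and b: "frame b F" "frame (b \<circ> w) G"
    and t: "transversal CARD('m) F G" and k: "k \<in> {1..CARD('m)}"
  shows "w k = CARD('m) + 1 - k"
proof -
  let ?N = "CARD('m)"
  have ge: "?N + 1 - k \<le> w k" if k: "k \<in> {1..?N}" for k
  proof (rule ccontr)
    assume "\<not> ?thesis"
    then have le: "k \<le> ?N - w k" "w k \<le> ?N" using k by auto
    have wk: "w k \<in> {1..?N}" using permutes_in_image[OF w] k by blast
    have "b (w k) \<in> mem F (w k) \<inter> mem G k" using b k wk by (auto simp: frame_def)
    then have "b (w k) \<in> mem F (w k) \<inter> mem G (?N - w k)" using mem_mono[OF le(1), of G] by auto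
    then have "b (w k) = 0" using t le(2) by (auto simp: transversal_def)
    then show False using b(1) wk zero_mem[of F "w k - 1"] by (metis frame_def)
  qed
  have "sum w {1..?N} = sum id {1..?N}"
    using sum.permute[OF w, of id] by simp
  also have "\<dots> = (\<Sum>k\<in>{1..?N}. ?N + 1 - k)"
    by (intro sum.reindex_bij_witness[of _ "\<lambda>k. ?N + 1 - k" "\<lambda>k. ?N + 1 - k"]) auto
  finally show ?thesis
    using sum_mono_inv[of "\<lambda>k. ?N + 1 - k" "{1..?N}" w k] ge k by simp
qed

section \<open>Matrices acting on chambers\<close>

lemma subspace_image_matrix: "vec.subspace U \<Longrightarrow> vec.subspace ((*v) A ` U)"
  for A :: "('a::field, 'm::finite) sq_matrix"
  by (rule vec.subspace_image)

lemma inj_matrix: "invertible A \<Longrightarrow> inj ((*v) A)"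
  for A :: "('a::field, 'm::finite) sq_matrix"
  by (rule injI) (metis invertible_def matrix_vector_mul_assoc matrix_vector_mul_lid)

lemma dim_image_matrix: "invertible A \<Longrightarrow> vec.dim ((*v) A ` U) = vec.dim U"
  for A :: "('a::field, 'm::finite) sq_matrix"
  using inj_matrix[of A] by (intro vec.dim_image_eq) (auto intro: inj_on_subset)

definition move :: "('a::field, 'm::finite) sq_matrix \<Rightarrow> ('a, 'm) chamber \<Rightarrow> ('a, 'm) chamber" where
  "move A F = chamber_of (\<lambda>i. (*v) A ` mem F i)"

lemma mem_move:
  assumes "invertible A"
  shows "mem (move A F) i = (*v) A ` mem F i"
proof -
  have "mem (move A F) = (\<lambda>i. (*v) A ` mem F i)"
    unfolding move_def using assms mem_Suc[of F]
    by (intro chamber_of_inverse) (auto simp: subspace_image_matrix dim_image_matrix dim_mem)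
  then show ?thesis by simp
qed

lemma image_matrix_mult: "(*v) (A ** B) ` U = (*v) A ` (*v) B ` U"
  by (auto simp: matrix_vector_mul_assoc[symmetric] image_image)

lemma move_mult: "invertible A \<Longrightarrow> invertible B \<Longrightarrow> move (A ** B) F = move A (move B F)"
  by (rule chamber_eqI) (simp add: mem_move invertible_mult image_matrix_mult)

lemma invertible_one: "invertible (mat 1 :: ('a::field, 'm::finite) sq_matrix)"
  unfolding invertible_def by (intro exI[of _ "mat 1"]) simp

lemma move_one: "move (mat 1) F = F"
  by (rule chamber_eqI) (simp add: mem_move invertible_one)

text \<open>
The number of an index of type \<open>'m\<close>, counted from \<open>1\<close> as in \<open>basis_vec\<close>.
\<close>

definition coordinate :: "'m::{finite,linorder} \<Rightarrow> nat" where
  "coordinate c = (THE i. i \<in> {1..CARD('m)} \<and> sorted_list_of_set UNIV ! (i - 1) = c)"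

lemma coordinate_unique:
  "\<exists>!i. i \<in> {1..CARD('m)} \<and> sorted_list_of_set UNIV ! (i - 1) = (c :: 'm::{finite,linorder})"
proof -
  let ?l = "sorted_list_of_set (UNIV :: 'm set)"
  have l: "distinct ?l" "length ?l = CARD('m)" "set ?l = UNIV" by simp_all
  then obtain j where j: "j < CARD('m)" "?l ! j = c" by (metis UNIV_I in_set_conv_nth)
  show ?thesis
  proof (rule ex1I[of _ "Suc j"])
    fix i assume i: "i \<in> {1..CARD('m)} \<and> ?l ! (i - 1) = c"
    then have "i - 1 = j" using l j nth_eq_iff_index_eq[of ?l "i - 1" j] by auto
    then show "i = Suc j" using i by auto
  qed (use j in auto)
qed

lemma coordinate: "coordinate c \<in> {1..CARD('m)}" "sorted_list_of_set UNIV ! (coordinate c - 1) = c"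
  for c :: "'m::{finite,linorder}"
  using theI'[OF coordinate_unique[of c]] by (auto simp: coordinate_def)

lemma coordinate_nth: "i \<in> {1..CARD('m)} \<Longrightarrow> coordinate (sorted_list_of_set UNIV ! (i - 1) :: 'm::{finite,linorder}) = i"
  using coordinate_unique[of "sorted_list_of_set UNIV ! (i - 1) :: 'm"] coordinate by blast

definition matrix_of_frame :: "(nat \<Rightarrow> 'a::field ^ 'm::{finite,linorder}) \<Rightarrow> ('a, 'm) sq_matrix" where
  "matrix_of_frame b = (\<chi> r c. b (coordinate c) $ r)"

lemma matrix_of_frame:
  "i \<in> {1..CARD('m)} \<Longrightarrow> matrix_of_frame b *v basis_vec i = (b i :: 'a::field ^ 'm::{finite,linorder})"
  using coordinate_nth[of i, where 'm = 'm]
  by (simp add: vec_eq_iff matrix_vector_mult_def basis_vec_def matrix_of_frame_def axis_def if_distrib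
      cong: if_cong)

lemma span_basis_vec: "vec.span (basis_vec ` {1..CARD('m)}) = (UNIV :: ('a::field ^ 'm::{finite,linorder}) set)"
proof -
  have "cart_basis \<subseteq> (basis_vec ` {1..CARD('m)} :: ('a, 'm) vec set)"
  proof
    fix x :: "('a, 'm) vec" assume "x \<in> cart_basis"
    then obtain c where "x = axis c 1" by (auto simp: cart_basis_def)
    then have "x = basis_vec (coordinate c)" using coordinate(2)[of c] by (simp add: basis_vec_def)
    then show "x \<in> basis_vec ` {1..CARD('m)}" using coordinate(1)[of c] by blast
  qed
  then have "vec.span cart_basis \<subseteq> vec.span (basis_vec ` {1..CARD('m)} :: (('a, 'm) vec) set)"
    by (rule vec.span_mono)
  then show ?thesis by (simp add: vec.span_Basis) blast
qed

lemma matrix_eq_on_basis: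
  fixes A B :: "('a::field, 'm::{finite,linorder}) sq_matrix"
  assumes "\<And>i. i \<in> {1..CARD('m)} \<Longrightarrow> A *v basis_vec i = B *v basis_vec i"
  shows "A = B"
proof -
  have "A *v x = B *v x" for x
    by (rule vec.linear_eq_on[of _ _ _ "basis_vec ` {1..CARD('m)}"])
      (use assms span_basis_vec in auto)
  then show ?thesis by (simp add: matrix_eq)
qed

definition std_chamber :: "('a::field, 'm::{finite,linorder}) chamber" where
  "std_chamber = chamber_of (\<lambda>i. vec.span (basis_vec ` {1..i}))"

lemma mem_std: "mem (std_chamber :: ('a::field, 'm::{finite,linorder}) chamber) i = vec.span (basis_vec ` {1..i})"
proof -
  have dim_le: "vec.dim (vec.span (basis_vec ` {1..i} :: (('a, 'm) vec) set)) \<le> i" for i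
    using vec.dim_le_card[of "vec.span (basis_vec ` {1..i} :: (('a, 'm) vec) set)" "basis_vec ` {1..i}"]
      card_image_le[of "{1..i}" "basis_vec :: nat \<Rightarrow> ('a, 'm) vec"] by auto
  have step: "vec.dim (vec.span (basis_vec ` {1..i + k} :: (('a, 'm) vec) set))
      \<le> vec.dim (vec.span (basis_vec ` {1..i} :: (('a, 'm) vec) set)) + k" for i k
  proof (induction k)
    case (Suc k)
    have "{1..i + Suc k} = insert (i + Suc k) {1..i + k}" by auto
    then have "vec.dim (vec.span (basis_vec ` {1..i + Suc k} :: (('a, 'm) vec) set))
       \<le> vec.dim (vec.span (basis_vec ` {1..i + k} :: (('a, 'm) vec) set)) + 1"
      by (simp add: vec.dim_insert)
    then show ?case using Suc by simp
  qed simp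
  have full: "vec.dim (vec.span (basis_vec ` {1..CARD('m)} :: (('a, 'm) vec) set)) = CARD('m)"
    unfolding span_basis_vec by (rule vec_dim_card)
  have dims: "vec.dim (vec.span (basis_vec ` {1..i} :: (('a, 'm) vec) set)) = min i CARD('m)" for i
  proof (cases "i \<le> CARD('m)")
    case True
    then show ?thesis using step[of i "CARD('m) - i"] dim_le[of i] full by simp
  next
    case False
    then have "basis_vec ` {1..CARD('m)} \<subseteq> (basis_vec ` {1..i} :: (('a, 'm) vec) set)"
      by (intro image_mono) auto
    then have "vec.dim (vec.span (basis_vec ` {1..i} :: (('a, 'm) vec) set)) \<ge> CARD('m)"
      using full by (metis vec.dim_span vec.dim_subset)
    moreover have "vec.dim (vec.span (basis_vec ` {1..i} :: (('a, 'm) vec) set)) \<le> CARD('m)"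
      using vec.dim_subset[of _ "UNIV :: (('a, 'm) vec) set"] vec_dim_card by (metis top_greatest)
    ultimately show ?thesis using False by simp
  qed
  have "mem (std_chamber :: ('a, 'm) chamber) = (\<lambda>i. vec.span (basis_vec ` {1..i}))"
    unfolding std_chamber_def
    by (rule chamber_of_inverse) (use dims in \<open>auto intro!: vec.span_mono image_mono\<close>)
  then show ?thesis by simp
qed

lemma image_span_matrix: "(*v) A ` vec.span U = vec.span ((*v) A ` U)"
  for A :: "('a::field, 'm::finite) sq_matrix"
  by (rule vec.linear_span_image[symmetric]) simp

lemma frame_matrix:
  fixes F :: "('a::field, 'm::{finite,linorder}) chamber"
  assumes "frame b F"
  shows "invertible (matrix_of_frame b)" "move (matrix_of_frame b) std_chamber = F"
proof -
  let ?A = "matrix_of_frame b :: ('a, 'm) sq_matrix"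
  have im: "(*v) ?A ` basis_vec ` {1..i} = b ` {1..i}" if "i \<le> CARD('m)" for i
    using that by (force simp: image_image matrix_of_frame)
  have "range ((*v) ?A) = UNIV"
    using frame_span[OF assms order_refl] im[of "CARD('m)"]
    by (metis image_span_matrix mem_full order_refl span_basis_vec)
  then show inv: "invertible ?A"
    by (metis invertible_right_inverse matrix_right_invertible_surjective)
  show "move ?A std_chamber = F"
  proof (rule chamber_eqI)
    fix i
    show "mem (move ?A std_chamber) i = mem F i"
    proof (cases "i \<le> CARD('m)")
      case True
      then show ?thesis
        using inv im[of i] frame_span[OF assms True] by (simp add: mem_move mem_std image_span_matrix)
    qed (simp add: mem_full)
  qed
qed

lemma chamber_transitive:
  fixes F :: "('a::field, 'm::{finite,linorder}) chamber"
  obtains A where "invertible A" "move A std_chamber = F"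
proof -
  obtain w b where "frame b F" using adapted_frame[of F F] by blast
  then show ?thesis using that frame_matrix by blast
qed

lemma perm_matrix_mult:
  assumes "\<And>i. i \<in> {1..CARD('m)} \<Longrightarrow> w i \<in> {1..CARD('m)}"
  shows "perm_matrix v ** perm_matrix w = (perm_matrix (v \<circ> w) :: ('a::field, 'm::{finite,linorder}) sq_matrix)"
  by (rule matrix_eq_on_basis)
    (use assms in \<open>simp add: matrix_vector_mul_assoc[symmetric] perm_matrix_basis_vec del: atLeastAtMost_iff\<close>)

lemma perm_matrix_id: "perm_matrix id = (mat 1 :: ('a::field, 'm::{finite,linorder}) sq_matrix)"
  by (rule matrix_eq_on_basis) (simp add: perm_matrix_basis_vec del: atLeastAtMost_iff)

lemma invertible_perm_matrix:
  assumes "w permutes {1..CARD('m)}"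
  shows "invertible (perm_matrix w :: ('a::field, 'm::{finite,linorder}) sq_matrix)"
proof -
  have "perm_matrix w ** perm_matrix (inv_into UNIV w) = (mat 1 :: ('a, 'm) sq_matrix)"
    using permutes_inv_o(1)[OF assms] permutes_in_image[OF permutes_inv[OF assms]]
    by (subst perm_matrix_mult) (auto simp: perm_matrix_id)
  then show ?thesis using invertible_right_inverse by blast
qed

lemma matrix_of_frame_perm:
  assumes "w permutes {1..CARD('m)}"
  shows "matrix_of_frame b ** perm_matrix w = (matrix_of_frame (b \<circ> w) :: ('a::field, 'm::{finite,linorder}) sq_matrix)"
  by (rule matrix_eq_on_basis)
    (use permutes_in_image[OF assms] in \<open>simp add: matrix_vector_mul_assoc[symmetric] perm_matrix_basis_vec matrix_of_frame del: atLeastAtMost_iff\<close>)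

section \<open>The projective linear group\<close>

lemma group_GL: "group (GL :: ('a::field, 'm::finite) sq_matrix monoid)"
proof (rule groupI)
  fix A :: "('a, 'm) sq_matrix" assume "A \<in> carrier GL"
  then obtain B where "A ** B = mat 1" "B ** A = mat 1" by (auto simp: GL_def invertible_def)
  then show "\<exists>B\<in>carrier GL. B \<otimes>\<^bsub>GL\<^esub> A = \<one>\<^bsub>GL\<^esub>"
    by (auto simp: GL_def invertible_def)
qed (auto simp: GL_def invertible_mult invertible_one matrix_mul_assoc)

lemma scalar_matrix_vector: "mat c *v x = c *s (x :: 'a::field ^ 'm::finite)"
  by (simp add: vec_eq_iff matrix_vector_mult_def mat_def if_distrib[of "\<lambda>y. y * _"] cong: if_cong)

lemma scalar_matrix_commute: "mat c ** A = A ** mat c"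
  for A :: "('a::field, 'm::finite) sq_matrix"
  by (simp add: matrix_eq matrix_vector_mul_assoc[symmetric] scalar_matrix_vector vec.scale)

lemma scalar_matrix_mult: "mat c ** mat d = (mat (c * d) :: ('a::field, 'm::finite) sq_matrix)"
  by (simp add: matrix_eq matrix_vector_mul_assoc[symmetric] scalar_matrix_vector)

lemma normal_scalar_matrices: "scalar_matrices \<lhd> (GL :: ('a::field, 'm::finite) sq_matrix monoid)"
proof -
  interpret GL: group "GL :: ('a, 'm) sq_matrix monoid" by (rule group_GL)
  have invertible: "invertible (mat c :: ('a, 'm) sq_matrix)" if "c \<noteq> 0" for c
    unfolding invertible_def using that by (intro exI[of _ "mat (1 / c)"]) (simp add: scalar_matrix_mult)
  have "subgroup scalar_matrices (GL :: ('a, 'm) sq_matrix monoid)"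
  proof (rule GL.subgroupI)
    fix A :: "('a, 'm) sq_matrix" assume "A \<in> scalar_matrices"
    then obtain c where c: "c \<noteq> 0" "A = mat c" by (auto simp: scalar_matrices_def)
    have "inv\<^bsub>GL\<^esub> A = mat (1 / c)"
      using c by (intro GL.inv_equality) (auto simp: GL_def invertible scalar_matrix_mult)
    then show "inv\<^bsub>GL\<^esub> A \<in> scalar_matrices" using c by (auto simp: scalar_matrices_def)
  next
    fix A B :: "('a, 'm) sq_matrix" assume "A \<in> scalar_matrices" "B \<in> scalar_matrices"
    then obtain c d where "c \<noteq> 0" "A = mat c" "d \<noteq> 0" "B = mat d" by (auto simp: scalar_matrices_def)
    then show "A \<otimes>\<^bsub>GL\<^esub> B \<in> scalar_matrices"
      by (auto simp: scalar_matrices_def GL_def scalar_matrix_mult intro!: exI[of _ "c * d"])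
  qed (auto simp: scalar_matrices_def GL_def invertible intro: exI[of _ 1])
  moreover have "A \<otimes>\<^bsub>GL\<^esub> h \<otimes>\<^bsub>GL\<^esub> inv\<^bsub>GL\<^esub> A \<in> scalar_matrices"
    if "A \<in> carrier GL" "h \<in> scalar_matrices" for A h :: "('a, 'm) sq_matrix"
  proof -
    have h: "h \<in> carrier GL" using that(2) by (auto simp: scalar_matrices_def GL_def invertible)
    have "A \<otimes>\<^bsub>GL\<^esub> h = h \<otimes>\<^bsub>GL\<^esub> A"
      using that(2) by (auto simp: scalar_matrices_def GL_def scalar_matrix_commute)
    then have "A \<otimes>\<^bsub>GL\<^esub> h \<otimes>\<^bsub>GL\<^esub> inv\<^bsub>GL\<^esub> A = h" using that(1) h by (simp add: GL.m_assoc)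
    then show ?thesis using that(2) by simp
  qed
  ultimately show ?thesis by (simp add: GL.normal_inv_iff)
qed

lemma group_PGL: "group (PGL :: ('a::field, 'm::finite) sq_matrix set monoid)"
  unfolding PGL_def by (rule normal.factorgroup_is_group[OF normal_scalar_matrices])

lemma carrier_PGL: "carrier PGL = proj_class ` {A :: ('a::field, 'm::finite) sq_matrix. invertible A}"
  by (auto simp: PGL_def FactGroup_def RCOSETS_def proj_class_def GL_def)

lemma proj_class_carrier [simp]: "invertible A \<Longrightarrow> proj_class A \<in> carrier PGL"
  by (simp add: carrier_PGL)

lemma proj_class_mult:
  fixes A B :: "('a::field, 'm::finite) sq_matrix"
  assumes "invertible A" "invertible B"
  shows "proj_class A \<otimes>\<^bsub>PGL\<^esub> proj_class B = proj_class (A ** B)"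
  using normal.rcos_sum[OF normal_scalar_matrices, of A B] assms
  by (simp add: PGL_def FactGroup_def proj_class_def) (simp add: GL_def)

lemma proj_class_one: "\<one>\<^bsub>PGL\<^esub> = proj_class (mat 1 :: ('a::field, 'm::finite) sq_matrix)"
  by (auto simp: PGL_def FactGroup_def proj_class_def r_coset_def GL_def)

lemma act_subspace_proj_class:
  fixes A :: "('a::field, 'm::finite) sq_matrix"
  assumes "vec.subspace U"
  shows "act_subspace (proj_class A) U = (*v) A ` U"
proof -
  have cls: "proj_class A = {mat c ** A | c. c \<noteq> 0}"
    by (auto simp: proj_class_def r_coset_def scalar_matrices_def GL_def)
  have sub: "vec.subspace ((*v) A ` U)" using assms by (rule subspace_image_matrix)
  show ?thesis
  proof
    show "act_subspace (proj_class A) U \<subseteq> (*v) A ` U"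
      using vec.subspace_scale[OF sub] by (auto simp: act_subspace_def cls matrix_vector_mul_assoc[symmetric] scalar_matrix_vector)
    have "A \<in> proj_class A" unfolding cls by (auto intro!: exI[of _ 1])
    then show "(*v) A ` U \<subseteq> act_subspace (proj_class A) U" by (auto simp: act_subspace_def)
  qed
qed

section \<open>Flags as parts of chambers\<close>

definition subflag :: "nat set \<Rightarrow> ('a::field, 'm::finite) chamber \<Rightarrow> ('a, 'm) flag" where
  "subflag J F = mem F ` ({1..<CARD('m)} - J)"

lemma act_subflag:
  assumes "invertible A"
  shows "act_flag (proj_class A) (subflag J F) = subflag J (move A F)"
  using assms by (auto simp: act_flag_def subflag_def act_subspace_proj_class mem_move image_image)

lemma subflag_eq_iff:
  fixes F G :: "('a::field, 'm::finite) chamber"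
  shows "subflag J F = subflag J G \<longleftrightarrow> (\<forall>i\<in>{1..<CARD('m)} - J. mem F i = mem G i)"
proof
  assume eq: "subflag J F = subflag J G"
  show "\<forall>i\<in>{1..<CARD('m)} - J. mem F i = mem G i"
  proof
    fix i assume i: "i \<in> {1..<CARD('m)} - J"
    then have "mem F i \<in> subflag J G" unfolding eq[symmetric] by (auto simp: subflag_def)
    then obtain j where "j \<in> {1..<CARD('m)} - J" "mem F i = mem G j" by (auto simp: subflag_def)
    moreover from this have "i = j" using i dim_mem_less[of i F] dim_mem_less[of j G] by auto
    ultimately show "mem F i = mem G i" by simp
  qed
qed (auto simp: subflag_def)

lemma subflag_empty_eq_iff: "subflag {} F = subflag {} G \<longleftrightarrow> F = G"
  for F G :: "('a::field, 'm::finite) chamber"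
proof
  assume "subflag {} F = subflag {} G"
  then have "mem F i = mem G i" for i
    by (cases "i = 0"; cases "i < CARD('m)") (auto simp: subflag_eq_iff mem_full)
  then show "F = G" by (rule chamber_eqI)
qed simp

lemma subflag_in_flags:
  fixes F :: "('a::field, 'm::finite) chamber"
  assumes "J \<subseteq> {1..<CARD('m)}"
  shows "subflag J F \<in> flags_of_cotype J"
proof -
  have proper: "mem F i \<noteq> {0} \<and> mem F i \<noteq> UNIV" if i: "i \<in> {1..<CARD('m)}" for i
  proof -
    have d: "vec.dim (mem F i) = i" using i by (intro dim_mem_less) simp
    have "vec.dim ({0} :: ('a ^ 'm) set) \<noteq> i" using i by simp
    moreover have "vec.dim (UNIV :: ('a ^ 'm) set) \<noteq> i" using i unfolding vec_dim_card by simp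
    ultimately show ?thesis using d by metis
  qed
  have chain: "mem F i \<subseteq> mem F j \<or> mem F j \<subseteq> mem F i" for i j
    using mem_mono[of i j F] mem_mono[of j i F] nat_le_linear[of i j] by blast
  have "is_flag (subflag J F)"
    unfolding is_flag_def subflag_def
  proof (intro conjI ballI)
    fix U W assume "U \<in> mem F ` ({1..<CARD('m)} - J)" "W \<in> mem F ` ({1..<CARD('m)} - J)"
    then obtain i j where "U = mem F i" "W = mem F j" by blast
    then show "U \<subseteq> W \<or> W \<subseteq> U" using chain[of i j] by simp
  qed (use proper in auto)
  moreover have "flag_type (subflag J F) = {1..<CARD('m)} - J"
  proof -
    have "vec.dim ` mem F ` ({1..<CARD('m)} - J) = (\<lambda>i. i) ` ({1..<CARD('m)} - J)"
      unfolding image_image by (intro image_cong) auto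
    then show ?thesis by (simp add: flag_type_def subflag_def)
  qed
  ultimately show ?thesis using assms unfolding flags_of_cotype_def flag_cotype_def by blast
qed

text \<open>
The chamber is built upwards, keeping every member comparable with all members of \<open>f\<close>: the next one is chosen
inside the smallest member of \<open>f\<close> that properly contains the present one. A member of the chamber comparable
with \<open>U\<close> and of the same dimension is \<open>U\<close>.
\<close>

lemma flag_extension:
  fixes f :: "('a::{field,finite}, 'm::finite) flag"
  assumes f: "is_flag f"
  obtains F where "\<And>U. U \<in> f \<Longrightarrow> mem F (vec.dim U) = U"
proof -
  define P where "P i W \<longleftrightarrow> vec.subspace W \<and> vec.dim W = min i CARD('m) \<and> (\<forall>U\<in>f. U \<subseteq> W \<or> W \<subseteq> U)"
    for i and W :: "('a ^ 'm) set"
  have fs: "vec.subspace U" if "U \<in> f" for U using f that by (simp add: is_flag_def)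
  have fchain: "U \<subseteq> W \<or> W \<subseteq> U" if "U \<in> f" "W \<in> f" for U W
    using f that by (simp add: is_flag_def)
  have step: "\<exists>W'. P (Suc i) W' \<and> W \<subseteq> W'" if W: "P i W" for i W
  proof (cases "i < CARD('m)")
    case False
    then show ?thesis using W by (intro exI[of _ W]) (auto simp: P_def)
  next
    case True
    define S where "S = {U \<in> insert UNIV f. W \<subset> U}"
    have "W \<noteq> UNIV" using W True vec_dim_card[where ?'a = 'a and ?'n = 'm] by (auto simp: P_def simp del: vec.dim_UNIV)
    then have "S \<noteq> {}" "finite S" by (auto simp: S_def)
    then obtain X where X: "X \<in> S" "\<And>U. U \<in> S \<Longrightarrow> vec.dim X \<le> vec.dim U"
      using arg_min_if_finite[of S vec.dim] by (metis linorder_not_le)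
    have sX: "vec.subspace X" using X(1) fs by (auto simp: S_def)
    have sW: "vec.subspace W" "vec.dim W = i" using W True by (auto simp: P_def)
    have XU: "X \<subseteq> U" if U: "U \<in> S" for U
    proof -
      have sU: "vec.subspace U" using U fs by (auto simp: S_def)
      have "X = UNIV \<or> X \<in> f" "U = UNIV \<or> U \<in> f" using X(1) U by (simp_all add: S_def)
      then have "X \<subseteq> U \<or> U \<subseteq> X" using fchain[of X U] by auto
      then show ?thesis
      proof
        assume "U \<subseteq> X"
        then have "U = X" using sU sX X(2)[OF U] by (intro subspace_eqI)
        then show ?thesis by simp
      qed
    qed
    have "W \<subset> X" using X(1) by (auto simp: S_def)
    then have "i < vec.dim X" using dim_psubset_less[OF sW(1) sX] sW by simp
    then obtain W' where W': "vec.subspace W'" "W \<subseteq> W'" "W' \<subseteq> X" "vec.dim W' = Suc i"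
      using subspace_between[OF sW(1) sX, of "Suc i"] \<open>W \<subset> X\<close> sW by auto
    have "U \<subseteq> W' \<or> W' \<subseteq> U" if U: "U \<in> f" for U
    proof (cases "U \<subseteq> W")
      case False
      then have "U \<in> S" using W U by (auto simp: P_def S_def)
      then show ?thesis using XU W' by blast
    qed (use W' in auto)
    then show ?thesis using W' True by (intro exI[of _ W']) (auto simp: P_def)
  qed
  have "P 0 {0}" using fs vec.subspace_0 by (auto simp: P_def)
  then obtain c where c: "\<And>i. P i (c i)" "\<And>i. c i \<subseteq> c (Suc i)"
    using dependent_nat_choice[of P "\<lambda>_ W W'. W \<subseteq> W'"] step by metis
  then have m: "mem (chamber_of c) = c"
    by (intro chamber_of_inverse) (auto simp: P_def)
  show ?thesis
  proof (rule that[of "chamber_of c"])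
    fix U assume U: "U \<in> f"
    have dU: "vec.dim U \<le> CARD('m)"
      using vec.dim_subset[of U UNIV] vec_dim_card[where ?'a = 'a and ?'n = 'm] by simp
    have "c (vec.dim U) = U"
      using c(1)[of "vec.dim U"] U fs[OF U] dU subspace_eqI[of U "c (vec.dim U)"]
        subspace_eqI[of "c (vec.dim U)" U] by (auto simp: P_def)
    then show "mem (chamber_of c) (vec.dim U) = U" by (simp add: m)
  qed
qed

lemma flags_of_cotype_eq:
  assumes "J \<subseteq> {1..<CARD('m)}"
  shows "flags_of_cotype J = range (subflag J :: ('a::{field,finite}, 'm::finite) chamber \<Rightarrow> _)"
proof
  show "range (subflag J) \<subseteq> (flags_of_cotype J :: ('a, 'm) flag set)"
    using subflag_in_flags[OF assms] by auto
  show "(flags_of_cotype J :: ('a, 'm) flag set) \<subseteq> range (subflag J)"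
  proof
    fix f :: "('a, 'm) flag" assume "f \<in> flags_of_cotype J"
    then have f: "is_flag f" "flag_cotype f = J" by (auto simp: flags_of_cotype_def)
    obtain F where F: "\<And>U. U \<in> f \<Longrightarrow> mem F (vec.dim U) = U" using flag_extension[OF f(1)] by blast
    have "vec.dim U \<in> {1..<CARD('m)}" if U: "U \<in> f" for U
    proof -
      have s: "vec.subspace U" "U \<noteq> {0}" "U \<noteq> UNIV" using f(1) U by (auto simp: is_flag_def)
      then have "{0} \<subset> U" using vec.subspace_0[OF s(1)] by auto
      then have "0 < vec.dim U" using dim_psubset_less[of "{0}" U] s by simp
      moreover have "vec.dim U < CARD('m)"
        using dim_psubset_less[of U UNIV] s vec_dim_card[where ?'a = 'a and ?'n = 'm] by auto
      ultimately show ?thesis by simp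
    qed
    then have "flag_type f = {1..<CARD('m)} - J"
      using f(2) by (auto simp: flag_cotype_def flag_type_def)
    then have "mem F ` (vec.dim ` f) = subflag J F" by (simp add: flag_type_def subflag_def)
    moreover have "mem F ` (vec.dim ` f) = f" using F by (force simp: image_image)
    ultimately show "f \<in> range (subflag J)" by auto
  qed
qed

lemma std_flag_eq: "std_flag = subflag {} (std_chamber :: ('a::field, 'm::{finite,linorder}) chamber)"
  by (simp add: std_flag_def subflag_def mem_std)

lemma borel_iff:
  fixes A :: "('a::field, 'm::{finite,linorder}) sq_matrix"
  assumes "invertible A"
  shows "proj_class A \<in> borel_subgroup \<longleftrightarrow> move A std_chamber = std_chamber"
  using assms by (simp add: borel_subgroup_def std_flag_eq act_subflag subflag_empty_eq_iff)

section \<open>Parabolic subgroups are flag stabilizers\<close>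

text \<open>
From right to left this is bubble sort: a permutation \<open>w \<noteq> id\<close> has a descent \<open>w (i + 1) < w i\<close>. Here \<open>i\<close> belongs to \<open>J\<close> because \<open>w\<close> cannot map
\<open>{1..i}\<close> to itself, and multiplication by \<open>s\<^sub>i\<close> increases \<open>\<Sum>j. j * w j\<close>.
\<close>

lemma weyl_parabolic_iff:
  assumes "J \<subseteq> {1..n}"
  shows "w \<in> weyl_parabolic n J \<longleftrightarrow>
    w permutes {1..n + 1} \<and> (\<forall>k\<in>{1..n} - J. w ` {1..k} = {1..k})" (is "_ \<longleftrightarrow> ?R w")
proof
  let ?t = "\<lambda>i::nat. Transposition.transpose i (i + 1)"
  have tp: "?t i permutes {1..n + 1}" if "i \<in> {1..n}" for i
    using that by (intro permutes_swap_id) auto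
  have tk: "?t i ` {1..k} = {1..k}" if "i \<noteq> k" "i \<ge> 1" for i k
  proof (cases "i < k")
    case True
    then show ?thesis using that by (intro permutes_image permutes_swap_id) auto
  next
    case False
    then have "?t i j = j" if "j \<in> {1..k}" for j using that \<open>i \<noteq> k\<close> by (auto simp: transpose_def)
    then show ?thesis by force
  qed
  have tR: "?R (?t i)" if i: "i \<in> J" for i
  proof (intro conjI ballI)
    show "?t i permutes {1..n + 1}" using tp i assms by blast
    fix k assume "k \<in> {1..n} - J"
    then show "?t i ` {1..k} = {1..k}" using i assms by (intro tk) auto
  qed
  show "?R w" if "w \<in> weyl_parabolic n J"
    using that unfolding weyl_parabolic_def
  proof (induction rule: generate.induct)
    case one
    then show ?case using permutes_id[of "{1..n + 1}"] by (simp only: sym_group_one) simp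
  next
    case (incl h)
    then show ?case using tR by blast
  next
    case (inv h)
    then obtain i where i: "i \<in> J" "h = ?t i" by auto
    interpret S: group "sym_group (n + 1)" by (rule sym_group_is_group)
    have "h \<in> carrier (sym_group (n + 1))" using tp i assms by (auto simp: sym_group_carrier)
    moreover have "h \<otimes>\<^bsub>sym_group (n + 1)\<^esub> h = \<one>\<^bsub>sym_group (n + 1)\<^esub>"
      using i by (simp add: sym_group_mult sym_group_one)
    ultimately have "inv\<^bsub>sym_group (n + 1)\<^esub> h = h" by (intro S.inv_equality)
    then show ?case using i tR by simp
  next
    case (eng v w)
    then have "(v \<circ> w) ` {1..k} = {1..k}" if "k \<in> {1..n} - J" for k
      using that by (simp only: image_comp[symmetric])
    then show ?case using eng permutes_compose[of w "{1..n + 1}" v] unfolding sym_group_mult by blast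
  qed
  \<comment> \<open>The induction is on \<open>M - m w\<close>, where \<open>m\<close> grows with each sorting step and is bounded by \<open>M\<close>.\<close>
  define M where "M = (n + 1) * ((n + 1) * (n + 1))"
  define m where "m w = (\<Sum>j\<in>{1..n + 1}. j * w j)" for w :: "nat \<Rightarrow> nat"
  have m_bound: "m w \<le> M" if "w permutes {1..n + 1}" for w
  proof -
    have "w j \<le> n + 1" if "j \<in> {1..n + 1}" for j
      using permutes_in_image[OF \<open>w permutes _\<close>, of j] that by auto
    then have "m w \<le> (\<Sum>j\<in>{1..n + 1}. (n + 1) * (n + 1))"
      unfolding m_def by (intro sum_mono mult_le_mono) auto
    then show ?thesis by (simp add: M_def)
  qed
  show "w \<in> weyl_parabolic n J" if "?R w"
    using that
  proof (induction "M - m w" arbitrary: w rule: less_induct)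
    case less
    then have w: "w permutes {1..n + 1}" and wk: "\<And>k. k \<in> {1..n} - J \<Longrightarrow> w ` {1..k} = {1..k}" by auto
    show ?case
    proof (cases "\<exists>i\<in>{1..n}. w (i + 1) < w i")
      case False
      have ge: "j \<le> w j" if "j \<in> {1..n + 1}" for j
        using that
      proof (induction j)
        case (Suc j)
        show ?case
        proof (cases "j = 0")
          case True
          then show ?thesis using permutes_in_image[OF w, of "Suc j"] Suc.prems by auto
        next
          case j: False
          then have "w j < w (Suc j)"
            using False Suc.prems permutes_inj[OF w] by (metis Suc_eq_plus1 Suc_le_mono atLeastAtMost_iff
                inj_eq le0 linorder_neqE_nat n_not_Suc_n not_less_eq_eq One_nat_def Suc_leI neq0_conv)
          then show ?thesis using Suc j by auto
        qed
      qed simp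
      have "sum id {1..n + 1} = sum w {1..n + 1}" using sum.permute[OF w, of id] by simp
      then have "j = w j" if "j \<in> {1..n + 1}" for j
        using sum_mono_inv[of id "{1..n + 1}" w j] ge that by simp
      moreover have "w j = j" if "j \<notin> {1..n + 1}" for j using w that by (rule permutes_not_in)
      ultimately have "w j = j" for j by metis
      then have "w = id" by (simp add: fun_eq_iff)
      then show ?thesis unfolding weyl_parabolic_def using generate.one by (metis sym_group_one)
    next
      case True
      then obtain i where i: "i \<in> {1..n}" "w (i + 1) < w i" by auto
      have "i \<in> J"
      proof (rule ccontr)
        assume "i \<notin> J"
        then have wi: "w ` {1..i} = {1..i}" using wk i by simp
        then have "w i \<le> i" using i by (metis atLeastAtMost_iff imageI order_refl)
        moreover have "w (i + 1) \<notin> w ` {1..i}" using permutes_inj[OF w] by (auto simp: inj_image_mem_iff)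
        moreover have "w (i + 1) \<in> {1..n + 1}" using permutes_in_image[OF w, of "i + 1"] i by auto
        ultimately show False using wi i by auto
      qed
      define v where "v = w \<circ> ?t i"
      have vp: "v permutes {1..n + 1}" unfolding v_def using w tp i by (intro permutes_compose) auto
      have vk: "v ` {1..k} = {1..k}" if "k \<in> {1..n} - J" for k
      proof -
        have "i \<noteq> k" using that \<open>i \<in> J\<close> by auto
        then have "?t i ` {1..k} = {1..k}" using tk i by auto
        then show ?thesis using wk[OF that] unfolding v_def image_comp[symmetric] by (simp only:)
      qed
      define R where "R = {1..n + 1} - {i, i + 1}"
      have split: "sum f {1..n + 1} = f i + f (i + 1) + sum f R" for f :: "nat \<Rightarrow> nat"
      proof -
        have "{1..n + 1} = insert i (insert (i + 1) R)" using i by (auto simp: R_def)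
        moreover have "i \<notin> insert (i + 1) R" "i + 1 \<notin> R" "finite R" by (auto simp: R_def)
        ultimately show ?thesis by simp
      qed
      have "sum (\<lambda>j. j * v j) R = sum (\<lambda>j. j * w j) R"
        by (intro sum.cong) (auto simp: v_def R_def transpose_def)
      moreover have "v i = w (i + 1)" "v (i + 1) = w i" by (simp_all add: v_def)
      moreover have "i * w i + (i + 1) * w (i + 1) < i * w (i + 1) + (i + 1) * w i"
        using i(2) by simp
      ultimately have "m w < m v" by (simp only: m_def split add_less_cancel_right)
      then have "M - m v < M - m w" using m_bound[OF vp] by linarith
      then have "v \<in> weyl_parabolic n J" using less.hyps[of v] vp vk by auto
      moreover have "?t i \<in> weyl_parabolic n J"
        unfolding weyl_parabolic_def using \<open>i \<in> J\<close> by (intro generate.incl) auto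
      ultimately have "v \<circ> ?t i \<in> weyl_parabolic n J"
        unfolding weyl_parabolic_def using generate.eng by (metis sym_group_mult)
      moreover have "v \<circ> ?t i = w" by (simp add: v_def comp_assoc)
      ultimately show ?thesis by simp
    qed
  qed
qed

definition flag_stabilizer :: "nat set \<Rightarrow> ('a::field, 'm::{finite,linorder}) sq_matrix set set" where
  "flag_stabilizer J = {g \<in> carrier PGL. act_flag g (subflag J std_chamber) = subflag J std_chamber}"

lemma flag_stabilizer_iff:
  "invertible A \<Longrightarrow> proj_class A \<in> flag_stabilizer J \<longleftrightarrow> subflag J (move A std_chamber) = subflag J std_chamber"
  by (simp add: flag_stabilizer_def act_subflag)

lemma act_flag_mult:
  fixes g h :: "('a::field, 'm::finite) sq_matrix set"
  assumes "g \<in> carrier PGL" "h \<in> carrier PGL"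
  shows "act_flag (g \<otimes>\<^bsub>PGL\<^esub> h) (subflag J F) = act_flag g (act_flag h (subflag J F))"
  using assms by (auto simp: carrier_PGL proj_class_mult act_subflag invertible_mult move_mult)

lemma act_flag_one: "act_flag \<one>\<^bsub>PGL\<^esub> (subflag J F) = subflag J F"
  by (simp add: proj_class_one act_subflag invertible_one move_one)

lemma subgroup_flag_stabilizer:
  "subgroup (flag_stabilizer J) (PGL :: ('a::field, 'm::{finite,linorder}) sq_matrix set monoid)"
proof -
  interpret P: group "PGL :: ('a, 'm) sq_matrix set monoid" by (rule group_PGL)
  show ?thesis
  proof (rule P.subgroupI)
    show "flag_stabilizer J \<noteq> ({} :: ('a, 'm) sq_matrix set set)"
      using act_flag_one[of J "std_chamber :: ('a, 'm) chamber"] by (auto simp: flag_stabilizer_def)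
  next
    fix g :: "('a, 'm) sq_matrix set" assume g: "g \<in> flag_stabilizer J"
    then have gc: "g \<in> carrier PGL" by (simp add: flag_stabilizer_def)
    have "act_flag (inv\<^bsub>PGL\<^esub> g) (subflag J std_chamber)
        = act_flag (inv\<^bsub>PGL\<^esub> g) (act_flag g (subflag J std_chamber))"
      using g by (simp add: flag_stabilizer_def)
    also have "\<dots> = subflag J std_chamber"
      using gc by (simp add: act_flag_mult[symmetric] act_flag_one)
    finally show "inv\<^bsub>PGL\<^esub> g \<in> flag_stabilizer J" using gc by (simp add: flag_stabilizer_def)
  qed (auto simp: flag_stabilizer_def act_flag_mult)
qed

text \<open>
Let \<open>g\<close> stabilize the flag, and take a frame adapted to the standard chamber \<open>F\<close> and to \<open>g F\<close>, with
permutation \<open>w\<close>. Its matrix is in \<open>B\<close> and together with \<open>w\<close> takes \<open>F\<close> to \<open>g F\<close>, so that \<open>g\<close> is in \<open>B w B\<close>. As \<open>F\<close>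
and \<open>g F\<close> have the members of dimension \<open>k \<notin> J\<close> in common, \<open>w\<close> preserves \<open>{1..k}\<close> for these \<open>k\<close>.
\<close>

theorem parabolic_eq_flag_stabilizer:
  assumes J: "J \<subseteq> {1..<CARD('m)}"
  shows "parabolic J = (flag_stabilizer J :: ('a::field, 'm::{finite,linorder}) sq_matrix set set)"
proof
  let ?n = "CARD('m) - 1"
  interpret P: group "PGL :: ('a, 'm) sq_matrix set monoid" by (rule group_PGL)
  interpret S: subgroup "flag_stabilizer J" "PGL :: ('a, 'm) sq_matrix set monoid"
    by (rule subgroup_flag_stabilizer)
  have "{1..<CARD('m)} = {1..?n}" by auto
  then have n: "?n + 1 = CARD('m)" "J \<subseteq> {1..?n}" "{1..<CARD('m)} = {1..?n}" using J by auto
  have borel: "borel_subgroup \<subseteq> (flag_stabilizer J :: ('a, 'm) sq_matrix set set)"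
  proof
    fix g :: "('a, 'm) sq_matrix set" assume g: "g \<in> borel_subgroup"
    then obtain A where A: "invertible A" "g = proj_class A"
      by (auto simp: borel_subgroup_def carrier_PGL)
    then show "g \<in> flag_stabilizer J" using g by (simp add: borel_iff flag_stabilizer_iff)
  qed
  have weyl: "weyl w \<in> (flag_stabilizer J :: ('a, 'm) sq_matrix set set)" if w: "w \<in> weyl_parabolic ?n J" for w
  proof -
    have wp: "w permutes {1..CARD('m)}" and wk: "\<And>k. k \<in> {1..?n} - J \<Longrightarrow> w ` {1..k} = {1..k}"
      using w weyl_parabolic_iff[OF n(2)] n(1) by auto
    have "mem (move (perm_matrix w) (std_chamber :: ('a, 'm) chamber)) i = mem std_chamber i"
      if i: "i \<in> {1..<CARD('m)} - J" for i
    proof -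
      have "(*v) (perm_matrix w) ` basis_vec ` {1..i} = (basis_vec ` w ` {1..i} :: ('a, 'm) vec set)"
        unfolding image_image using i by (intro image_cong refl perm_matrix_basis_vec) auto
      also have "w ` {1..i} = {1..i}" using wk[of i] i n(3) by blast
      finally show ?thesis
        using wp by (simp add: mem_move invertible_perm_matrix mem_std image_span_matrix)
    qed
    then show ?thesis
      unfolding weyl_def flag_stabilizer_iff[OF invertible_perm_matrix[OF wp]] subflag_eq_iff by blast
  qed
  show "parabolic J \<subseteq> (flag_stabilizer J :: ('a, 'm) sq_matrix set set)"
    using borel weyl by (auto simp: parabolic_def set_mult_def)
  show "(flag_stabilizer J :: ('a, 'm) sq_matrix set set) \<subseteq> parabolic J"
  proof
    fix g :: "('a, 'm) sq_matrix set" assume g: "g \<in> flag_stabilizer J"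
    then obtain A where A: "invertible A" "g = proj_class A"
      by (auto simp: flag_stabilizer_def carrier_PGL)
    define G where "G = move A std_chamber"
    have same: "mem G k = mem std_chamber k" if "k \<in> {1..?n} - J" for k
      using g that A n by (simp add: flag_stabilizer_iff subflag_eq_iff G_def)
    obtain w b where w: "w permutes {1..CARD('m)}" and b: "frame b std_chamber" "frame (b \<circ> w) G"
      using adapted_frame[of std_chamber G] by blast
    have "w ` {1..k} = {1..k}" if k: "k \<in> {1..?n} - J" for k
    proof (rule endo_inj_surj)
      show "w ` {1..k} \<subseteq> {1..k}"
      proof safe
        fix j assume j: "j \<in> {1..k}"
        then have jN: "j \<in> {1..CARD('m)}" using k by auto
        then have wj: "w j \<in> {1..CARD('m)}" using permutes_in_image[OF w] by blast
        have "b (w j) \<in> mem G k"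
          using b(2) jN j mem_mono[of j k G] by (auto simp: frame_def)
        then have "b (w j) \<in> mem std_chamber k" by (simp only: same[OF k])
        moreover have "b (w j) \<notin> mem std_chamber (w j - 1)" using b(1) wj by (auto simp: frame_def)
        ultimately have "\<not> k \<le> w j - 1" using mem_mono[of k "w j - 1"] by blast
        then show "w j \<in> {1..k}" using wj by auto
      qed
    qed (use permutes_inj[OF w] in \<open>auto intro: inj_on_subset\<close>)
    then have wW: "w \<in> weyl_parabolic ?n J" using weyl_parabolic_iff[OF n(2)] w n(1) by auto
    define M where "M = (matrix_of_frame b :: ('a, 'm) sq_matrix)"
    have M: "invertible M" "move M std_chamber = std_chamber" using frame_matrix[OF b(1)] by (auto simp: M_def)
    have Pw: "invertible (perm_matrix w :: ('a, 'm) sq_matrix)" by (rule invertible_perm_matrix[OF w])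
    have MP: "invertible (M ** perm_matrix w)" "move (M ** perm_matrix w) std_chamber = G"
      using frame_matrix[OF b(2)] by (auto simp: M_def matrix_of_frame_perm[OF w])
    obtain Z where Z: "(M ** perm_matrix w) ** Z = mat 1" "Z ** (M ** perm_matrix w) = mat 1"
      using MP(1) by (auto simp: invertible_def)
    then have iZ: "invertible Z" by (auto simp: invertible_def)
    have "move Z G = std_chamber"
      using MP iZ Z by (metis move_mult move_one)
    then have "move (Z ** A) std_chamber = std_chamber"
      using iZ A(1) by (simp add: move_mult G_def)
    then have "proj_class (Z ** A) \<in> borel_subgroup" using iZ A(1) by (simp add: borel_iff invertible_mult)
    moreover have "proj_class M \<in> borel_subgroup" using M by (simp add: borel_iff)
    moreover have "(M ** perm_matrix w) ** (Z ** A) = A" using Z by (simp add: matrix_mul_assoc)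
    then have "g = proj_class M \<otimes>\<^bsub>PGL\<^esub> weyl w \<otimes>\<^bsub>PGL\<^esub> proj_class (Z ** A)"
      using A M Pw iZ by (simp add: weyl_def proj_class_mult invertible_mult)
    ultimately show "g \<in> parabolic J" using wW by (auto simp: parabolic_def set_mult_def)
  qed
qed

section \<open>Opposite chambers, and counting\<close>

text \<open>
By \<open>transversal_adapted\<close> the two chambers are \<open>g F\<close> and \<open>g w\<^sub>0 F\<close> for the standard chamber \<open>F\<close>, and
\<open>(g w\<^sub>0)\<^sup>-\<^sup>1 g = w\<^sub>0\<close> because \<open>w\<^sub>0\<close> is an involution.
\<close>

lemma transversal_opposite_maximal:
  fixes F G :: "('a::field, 'm::{finite,linorder}) chamber"
  assumes "transversal CARD('m) F G"
  shows "opposite_maximal (subflag {} F) (subflag {} G)"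
proof -
  interpret P: group "PGL :: ('a, 'm) sq_matrix set monoid" by (rule group_PGL)
  obtain w b where w: "w permutes {1..CARD('m)}" and b: "frame b F" "frame (b \<circ> w) G"
    using adapted_frame[of F G] by blast
  have wk: "w k = CARD('m) + 1 - k" if "k \<in> {1..CARD('m)}" for k
    by (rule transversal_adapted[OF w b assms that])
  have N: "CARD('m) > 0" by simp
  have w_eq: "w = longest_perm (CARD('m) - 1)"
  proof
    fix k
    show "w k = longest_perm (CARD('m) - 1) k"
      using wk[of k] permutes_not_in[OF w, of k] N
      by (cases "k \<in> {1..CARD('m)}") (auto simp: longest_perm_def)
  qed
  have "w (w k) = k" for k
  proof (cases "k \<in> {1..CARD('m)}")
    case True
    then have "w k \<in> {1..CARD('m)}" using permutes_in_image[OF w] by blast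
    then show ?thesis using wk[of k] wk[of "w k"] True by auto
  qed (use permutes_not_in[OF w] in simp)
  then have "w \<circ> w = id" by (simp add: fun_eq_iff)
  then have "perm_matrix w ** perm_matrix w = (mat 1 :: ('a, 'm) sq_matrix)"
    using perm_matrix_mult[of w w] permutes_in_image[OF w] perm_matrix_id by metis
  moreover have Pw: "invertible (perm_matrix w :: ('a, 'm) sq_matrix)" by (rule invertible_perm_matrix[OF w])
  ultimately have ww: "inv\<^bsub>PGL\<^esub> weyl w = (weyl w :: ('a, 'm) sq_matrix set)"
    by (intro P.inv_equality) (simp_all add: weyl_def proj_class_mult proj_class_one)
  define M where "M = (matrix_of_frame b :: ('a, 'm) sq_matrix)"
  have M: "invertible M" "move M std_chamber = F" using frame_matrix[OF b(1)] by (auto simp: M_def)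
  have MP: "invertible (M ** perm_matrix w)" "move (M ** perm_matrix w) std_chamber = G"
    using frame_matrix[OF b(2)] by (auto simp: M_def matrix_of_frame_perm[OF w])
  define g where "g = proj_class M"
  define h where "h = g \<otimes>\<^bsub>PGL\<^esub> weyl w"
  have gc: "g \<in> carrier PGL" and wc: "weyl w \<in> carrier (PGL :: ('a, 'm) sq_matrix set monoid)"
    using M Pw by (auto simp: g_def weyl_def)
  have h: "h = proj_class (M ** perm_matrix w)" using M Pw by (simp add: h_def g_def weyl_def proj_class_mult)
  have "inv\<^bsub>PGL\<^esub> h \<otimes>\<^bsub>PGL\<^esub> g = weyl w"
    using gc wc by (simp add: h_def P.inv_mult_group P.m_assoc ww)
  moreover have "subflag {} F = act_flag g std_flag" "subflag {} G = act_flag h std_flag"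
    using M MP by (simp_all add: h g_def std_flag_eq act_subflag)
  ultimately show ?thesis
    unfolding opposite_maximal_def w_eq[symmetric] using gc wc
    by (intro bexI[of _ g] bexI[of _ h]) (auto simp: h_def)
qed

lemma card_image_eq_if_same_fibres:
  assumes "\<And>x y. x \<in> A \<Longrightarrow> y \<in> A \<Longrightarrow> f x = f y \<longleftrightarrow> g x = g y"
  shows "card (f ` A) = card (g ` A)"
proof (rule bij_betw_same_card)
  have g: "g (inv_into A f (f x)) = g x" if "x \<in> A" for x
    using that assms by (metis f_inv_into_f image_eqI inv_into_into)
  show "bij_betw (\<lambda>y. g (inv_into A f y)) (f ` A) (g ` A)"
  proof (rule bij_betw_imageI)
    show "inj_on (\<lambda>y. g (inv_into A f y)) (f ` A)"
      using assms by (auto simp: inj_on_def g)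
    show "(\<lambda>y. g (inv_into A f y)) ` f ` A = g ` A"
      unfolding image_image by (intro image_cong refl g)
  qed
qed

text \<open>
The orbit-stabilizer correspondence. Since the cosets are right cosets, \<open>P\<^sub>J g\<close> corresponds to the flag
\<open>g\<^sup>-\<^sup>1 f\<close>.
\<close>

lemma card_rcosets_parabolic:
  assumes "J \<subseteq> {1..<CARD('m)}"
  shows "card (rcosets\<^bsub>PGL\<^esub> (parabolic J :: ('a::{field,finite}, 'm::{finite,linorder}) sq_matrix set set))
    = card (flags_of_cotype J :: ('a, 'm) flag set)"
proof -
  interpret P: group "PGL :: ('a, 'm) sq_matrix set monoid" by (rule group_PGL)
  let ?H = "flag_stabilizer J :: ('a, 'm) sq_matrix set set"
  let ?f = "subflag J std_chamber :: ('a, 'm) flag"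
  interpret S: subgroup ?H PGL by (rule subgroup_flag_stabilizer)
  define \<phi> where "\<phi> g = act_flag (inv\<^bsub>PGL\<^esub> g) ?f" for g
  have coset_iff: "?H #>\<^bsub>PGL\<^esub> g = ?H #>\<^bsub>PGL\<^esub> h \<longleftrightarrow> \<phi> g = \<phi> h"
    if g: "g \<in> carrier PGL" and h: "h \<in> carrier PGL" for g h
  proof -
    have "?H #>\<^bsub>PGL\<^esub> g = ?H #>\<^bsub>PGL\<^esub> h \<longleftrightarrow> g \<in> ?H #>\<^bsub>PGL\<^esub> h"
      using P.repr_independence[OF _ h S.subgroup_axioms] P.rcos_self[OF g S.subgroup_axioms] by blast
    also have "\<dots> \<longleftrightarrow> g \<otimes>\<^bsub>PGL\<^esub> inv\<^bsub>PGL\<^esub> h \<in> ?H"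
      using S.rcos_module[OF P.group_axioms h g] by blast
    also have "\<dots> \<longleftrightarrow> act_flag g (\<phi> h) = ?f"
      unfolding flag_stabilizer_def \<phi>_def mem_Collect_eq act_flag_mult[OF g P.inv_closed[OF h]]
      using P.m_closed[OF g P.inv_closed[OF h]] by blast
    also have "\<dots> \<longleftrightarrow> \<phi> g = \<phi> h"
    proof
      have "inv\<^bsub>PGL\<^esub> h \<in> proj_class ` {A. invertible A}"
        using P.inv_closed[OF h] by (simp only: carrier_PGL)
      then obtain A where A: "invertible A" "inv\<^bsub>PGL\<^esub> h = proj_class A" by blast
      have \<phi>h: "\<phi> h = subflag J (move A std_chamber)"
        unfolding \<phi>_def A(2) by (rule act_subflag[OF A(1)])
      assume "act_flag g (\<phi> h) = ?f"
      then have "\<phi> g = act_flag (inv\<^bsub>PGL\<^esub> g) (act_flag g (\<phi> h))" by (simp only: \<phi>_def)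
      also have "\<dots> = \<phi> h"
        unfolding \<phi>h act_flag_mult[OF P.inv_closed[OF g] g, symmetric] P.l_inv[OF g] act_flag_one ..
      finally show "\<phi> g = \<phi> h" .
    next
      assume "\<phi> g = \<phi> h"
      then have "act_flag g (\<phi> h) = act_flag g (act_flag (inv\<^bsub>PGL\<^esub> g) ?f)" by (simp only: \<phi>_def)
      also have "\<dots> = ?f"
        unfolding act_flag_mult[OF g P.inv_closed[OF g], symmetric] P.r_inv[OF g] act_flag_one ..
      finally show "act_flag g (\<phi> h) = ?f" .
    qed
    finally show ?thesis .
  qed
  have "card (rcosets\<^bsub>PGL\<^esub> ?H) = card ((\<lambda>g. ?H #>\<^bsub>PGL\<^esub> g) ` carrier PGL)"
    by (rule arg_cong[of _ _ card]) (auto simp: RCOSETS_def)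
  also have "\<dots> = card (\<phi> ` carrier PGL)"
    by (rule card_image_eq_if_same_fibres) (rule coset_iff)
  finally have "card (rcosets\<^bsub>PGL\<^esub> ?H) = card (\<phi> ` carrier PGL)" .
  moreover have "\<phi> ` carrier PGL = flags_of_cotype J"
  proof -
    have "\<phi> ` carrier PGL = (\<lambda>g. act_flag g ?f) ` (\<lambda>g. inv\<^bsub>PGL\<^esub> g) ` carrier PGL"
      by (simp add: \<phi>_def image_image)
    also have "(\<lambda>g. inv\<^bsub>PGL\<^esub> g) ` carrier PGL = carrier (PGL :: ('a, 'm) sq_matrix set monoid)"
      by (metis P.inv_closed P.inv_inv image_eqI image_subsetI subsetI subset_antisym)
    also have "(\<lambda>g. act_flag g ?f) ` carrier PGL = (\<lambda>A. subflag J (move A std_chamber)) ` {A. invertible A}"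
      unfolding carrier_PGL image_image by (intro image_cong refl) (simp add: act_subflag)
    also have "\<dots> = subflag J ` (\<lambda>A. move A std_chamber) ` {A. invertible A}"
      by (simp add: image_image)
    also have "(\<lambda>A. move A std_chamber) ` {A. invertible A} = (UNIV :: ('a, 'm) chamber set)"
      using chamber_transitive by (metis (mono_tags, lifting) UNIV_eq_I image_eqI mem_Collect_eq)
    finally show ?thesis using flags_of_cotype_eq[OF assms, where ?'a = 'a] by simp
  qed
  ultimately show ?thesis by (simp add: parabolic_eq_flag_stabilizer[OF assms])
qed

lemma card_chambers_over:
  fixes F :: "('a::{field,finite}, 'm::{finite,linorder}) chamber"
  shows "card {G. subflag J G = subflag J F} = card {G. subflag J G = subflag J (std_chamber :: ('a, 'm) chamber)}"
proof -
  obtain A where A: "invertible A" "move A std_chamber = F" by (rule chamber_transitive)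
  obtain B where B: "A ** B = mat 1" "B ** A = mat 1" using A by (auto simp: invertible_def)
  then have iB: "invertible B" by (auto simp: invertible_def)
  have AB: "move A (move B G) = G" "move B (move A G) = G" for G
    using A(1) iB B by (metis move_mult move_one)+
  have push: "subflag J (move D G) = subflag J (move D G')" if "invertible D" "subflag J G = subflag J G'" for D and G G' :: "('a, 'm) chamber"
    using that by (simp add: act_subflag[symmetric])
  have "bij_betw (move A) {G. subflag J G = subflag J std_chamber} {G. subflag J G = subflag J F}"
  proof (rule bij_betwI[of _ _ _ "move B"])
    show "move A \<in> {G. subflag J G = subflag J std_chamber} \<rightarrow> {G. subflag J G = subflag J F}"
      using push[OF A(1)] A(2) by blast
    show "move B \<in> {G. subflag J G = subflag J F} \<rightarrow> {G. subflag J G = subflag J std_chamber}"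
      using push[OF iB] AB(2)[of std_chamber] A(2) by fastforce
  qed (simp_all add: AB)
  then show ?thesis by (simp add: bij_betw_same_card)
qed

theorem theorem3p6:
  fixes n q v :: nat
    and J :: "nat set"
    and C :: "('a::{field,finite}, 'm::{finite,linorder}) flag set"
  assumes "CARD('m) = n + 1"
    and "n \<ge> 3"
    and "CARD('a) = q"
    and "J \<subseteq> {1..n}"
    and "J = conj_w0 n J"
    and "EKR_set J C"
    and "v = card (rcosets\<^bsub>PGL\<^esub> (parabolic J :: ('a, 'm) sq_matrix set set))"
  shows "v = card (flags_of_cotype J :: ('a, 'm) flag set) \<and>
         real (card C) \<le> real v / (1 + real q powr ((real n + 1) / 2))"
proof
  have "{1..<CARD('m)} = {1..n}" using assms(1) by auto
  then have J: "J \<subseteq> {1..<CARD('m)}" using assms(4) by simp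
  show v: "v = card (flags_of_cotype J :: ('a, 'm) flag set)"
    using assms(7) card_rcosets_parabolic[OF J, where ?'a = 'a] by simp
  let ?s = "subflag J :: ('a, 'm) chamber \<Rightarrow> ('a, 'm) flag"
  define m where "m = card {G. ?s G = ?s std_chamber}"
  have fibre: "card {G. ?s G = f} = m" if f: "f \<in> flags_of_cotype J" for f
    using f card_chambers_over[of J] unfolding flags_of_cotype_eq[OF J] m_def by auto
  have count: "card {G. ?s G \<in> D} = card D * m" if D: "D \<subseteq> flags_of_cotype J" for D
  proof -
    have "card {G. ?s G \<in> D} = card (\<Union>f\<in>D. {G. ?s G = f})" by (rule arg_cong[of _ _ card]) auto
    also have "\<dots> = (\<Sum>f\<in>D. card {G. ?s G = f})" by (rule card_UN_disjoint) auto
    also have "\<dots> = (\<Sum>f\<in>D. m)" using fibre D by (intro sum.cong) auto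
    finally show ?thesis by simp
  qed
  have C: "C \<subseteq> flags_of_cotype J" "\<And>f f'. f \<in> C \<Longrightarrow> f' \<in> C \<Longrightarrow> \<not> opposite f f'"
    using assms(6) by (auto simp: EKR_set_def)
  have "\<not> transversal CARD('m) F G" if FG: "?s F \<in> C" "?s G \<in> C" for F G
  proof
    assume "transversal CARD('m) F G"
    then have opp: "opposite_maximal (subflag {} F) (subflag {} G)" by (rule transversal_opposite_maximal)
    have max: "subflag {} H \<in> flags_of_cotype {}" "?s H \<subseteq> subflag {} H" for H :: "('a, 'm) chamber"
      using subflag_in_flags[of "{}" H] by (auto simp: subflag_def)
    have "flag_cotype (?s F) = J" "flag_cotype (?s G) = J"
      using FG C(1) by (auto simp: flags_of_cotype_def)
    then have "opposite (?s F) (?s G)"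
      unfolding opposite_def using assms(1,5)
      by (intro conjI exI[of _ "subflag {} F"] exI[of _ "subflag {} G"] max opp) simp
    then show False using C(2) FG by blast
  qed
  then have "real (card {G. ?s G \<in> C}) * (1 + real CARD('a) powr (real CARD('m) / 2))
      \<le> real CARD(('a, 'm) chamber)"
    by (intro chamber_EKR_bound) auto
  also have "CARD(('a, 'm) chamber) = v * m"
  proof -
    have "{G. ?s G \<in> flags_of_cotype J} = UNIV" using subflag_in_flags[OF J] by blast
    then show ?thesis using count[OF order_refl] v by (simp only:)
  qed
  finally have "real (card C * m) * (1 + real q powr ((real n + 1) / 2)) \<le> real (v * m)"
    using assms(1,3) count[OF C(1)] by (simp add: add.commute)
  then have "real m * (real (card C) * (1 + real q powr ((real n + 1) / 2))) \<le> real m * real v"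
    by (simp only: of_nat_mult mult_ac)
  moreover have "m > 0" unfolding m_def by (auto simp: card_gt_0_iff)
  ultimately have "real (card C) * (1 + real q powr ((real n + 1) / 2)) \<le> real v" by simp
  moreover have "1 + real q powr ((real n + 1) / 2) > 0" by (simp add: add_pos_nonneg)
  ultimately show "real (card C) \<le> real v / (1 + real q powr ((real n + 1) / 2))"
    by (simp add: pos_le_divide_eq)
qed

end
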